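(* Let $\phi\in L^2(\mathbb{R}^d)$, let $\Phi=|\hat\phi|^2$, and let $\{\lambda_k\}_{k\in\mathbb{Z}}$ be a sequence in $\mathbb{R}^d$. If $$\sup_{k\in\mathbb{Z}}\sum_{l\in\mathbb{Z}}\left|\hat\Phi(\lambda_k-\lambda_l)\right|<\infty,$$ then the system of translates $\{T_{\lambda_k}\phi\}_{k\in\mathbb{Z}}$ is a Bessel sequence.
   Context: Fourier transform: $\hat f(w)=\int_{\mathbb{R}^d}f(x)e^{-2\pi i x\cdot w}\,dx$, extended to $L^2(\mathbb{R}^d)$; $\Phi\in L^1(\mathbb{R}^d)$, so $\hat\Phi$ is given by the integral pointwise. $T_\lambda f(x)=f(x-\lambda)$. A sequence $\{\psi_k\}$ in a Hilbert space $\mathcal{H}$ (here $L^2(\mathbb{R}^d)$) is a Bessel sequence if there is $B>0$ with $\sum_k|\langle f,\psi_k\rangle|^2\le B\|f\|^2$ for all $f\in\mathcal{H}$. *)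

theory Defs
  imports "HOL-Analysis.Analysis"
begin

text \<open>
  The space of square-integrable complex functions is represented by functions rather than by
  classes modulo null sets; nothing below depends on the choice of representatives.
\<close>

definition L2 :: "('a::euclidean_space \<Rightarrow> complex) set" where
  "L2 = {f. f \<in> borel_measurable lebesgue \<and> integrable lebesgue (\<lambda>x. (cmod (f x))\<^sup>2)}"

definition inner_L2 :: "('a::euclidean_space \<Rightarrow> complex) \<Rightarrow> ('a \<Rightarrow> complex) \<Rightarrow> complex" where
  "inner_L2 f g = (LINT x|lebesgue. f x * cnj (g x))"

definition norm_L2 :: "('a::euclidean_space \<Rightarrow> complex) \<Rightarrow> real" where
  "norm_L2 f = sqrt (LINT x|lebesgue. (cmod (f x))\<^sup>2)"

text \<open>
  Membership in \<open>L2\<close> is part of the notion of convergence, because the integral in \<open>norm_L2\<close> is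
  \<open>0\<close> by convention when the integrand is not integrable.
\<close>

definition converges_L2 ::
    "(nat \<Rightarrow> 'a::euclidean_space \<Rightarrow> complex) \<Rightarrow> ('a \<Rightarrow> complex) \<Rightarrow> bool" where
  "converges_L2 F f \<longleftrightarrow>
     (\<forall>n. F n \<in> L2) \<and> f \<in> L2 \<and> (\<lambda>n. norm_L2 (\<lambda>x. F n x - f x)) \<longlonglongrightarrow> 0"

definition fourier_L1 :: "('a::euclidean_space \<Rightarrow> complex) \<Rightarrow> 'a \<Rightarrow> complex" where
  "fourier_L1 f w = (LINT x|lebesgue. f x * exp (- 2 * of_real pi * \<i> * of_real (x \<bullet> w)))"

text \<open>
  The extension by continuity from \<open>L1 \<inter> L2\<close> to \<open>L2\<close>: the limit of the Fourier integrals along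
  an approximating sequence. By Plancherel's theorem the limit exists and does not depend on the
  sequence up to a null set, so that the choice operator only picks a representative.
\<close>

definition is_fourier_L2 ::
    "('a::euclidean_space \<Rightarrow> complex) \<Rightarrow> ('a \<Rightarrow> complex) \<Rightarrow> bool" where
  "is_fourier_L2 f g \<longleftrightarrow>
     (\<exists>F. (\<forall>n. integrable lebesgue (F n)) \<and> converges_L2 F f
        \<and> converges_L2 (\<lambda>n. fourier_L1 (F n)) g)"

definition fourier_L2 :: "('a::euclidean_space \<Rightarrow> complex) \<Rightarrow> 'a \<Rightarrow> complex" where
  "fourier_L2 f = (SOME g. is_fourier_L2 f g)"

definition translate :: "'a::euclidean_space \<Rightarrow> ('a \<Rightarrow> complex) \<Rightarrow> 'a \<Rightarrow> complex" where
  "translate t f = (\<lambda>x. f (x - t))"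

text \<open>
  The sum is taken in the extended nonnegative reals, so the bound includes its convergence.
\<close>

definition bessel_L2 :: "('k \<Rightarrow> 'a::euclidean_space \<Rightarrow> complex) \<Rightarrow> bool" where
  "bessel_L2 \<psi> \<longleftrightarrow>
     (\<forall>k. \<psi> k \<in> L2) \<and>
     (\<exists>B>0. \<forall>f\<in>L2.
        (\<Sum>\<^sub>\<infinity>k. ennreal ((cmod (inner_L2 f (\<psi> k)))\<^sup>2)) \<le> ennreal (B * (norm_L2 f)\<^sup>2))"

end

theory Submission
  imports Defs "HOL-Probability.Characteristic_Functions"
begin

text \<open>
  By Plancherel the Gram matrix of the translates is \<open>\<langle>T\<^sub>s \<phi>, T\<^sub>t \<phi>\<rangle> = \<Phi>^(s - t)\<close>, so the
  hypothesis bounds its absolute row sums and Schur's test gives the Bessel bound.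

  For \<open>f \<in> L\<^sup>1 \<inter> L\<^sup>2\<close> the autocorrelation \<open>A t = \<langle>f, T\<^sub>t f\<rangle>\<close> is bounded, integrable and continuous, and its
  Fourier transform is \<open>\<bar>f^\<bar>\<^sup>2 \<ge> 0\<close>. Regularizing the inversion integral by Gaussians and letting
  their width tend to infinity, one first finds \<open>f^ \<in> L\<^sup>2\<close> by Fatou (inversion at \<open>0\<close>), and then
  \<open>\<integral> \<bar>f^\<bar>\<^sup>2 exp (2 \<pi> \<i> a \<bullet> w) dw = A a\<close> by dominated convergence. Both sides are continuous in the \<open>L\<^sup>2\<close> norm,
  which carries the identity over to \<open>L\<^sup>2\<close>. Since \<open>fourier_L2\<close> is a choice among \<open>L\<^sup>2\<close> limits, the existence of
  such a limit (completeness of \<open>L\<^sup>2\<close>) has to be proved as well.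
\<close>

section \<open>The pre-Hilbert space of square-integrable functions\<close>

lemma L2_measurable: "f \<in> L2 \<Longrightarrow> f \<in> borel_measurable lebesgue"
  by (simp add: L2_def)

lemma L2_integrable_square: "f \<in> L2 \<Longrightarrow> integrable lebesgue (\<lambda>x. (cmod (f x))\<^sup>2)"
  by (simp add: L2_def)

lemma L2_bound:
  assumes "f \<in> borel_measurable lebesgue" "integrable lebesgue b" "\<And>x. (cmod (f x))\<^sup>2 \<le> b x"
  shows "f \<in> L2"
proof -
  note [measurable] = assms(1)
  show ?thesis
    unfolding L2_def
    by (auto intro!: Bochner_Integration.integrable_bound[OF assms(2)] AE_I2 order_trans[OF assms(3) abs_ge_self])
qed

lemma L2_add:
  assumes "f \<in> L2" "g \<in> L2" shows "(\<lambda>x. f x + g x) \<in> L2"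
proof (rule L2_bound)
  show "integrable lebesgue (\<lambda>x. 2 * (cmod (f x))\<^sup>2 + 2 * (cmod (g x))\<^sup>2)"
    using assms by (auto simp: L2_def)
  show "(cmod (f x + g x))\<^sup>2 \<le> 2 * (cmod (f x))\<^sup>2 + 2 * (cmod (g x))\<^sup>2" for x
  proof -
    have "(cmod (f x + g x))\<^sup>2 \<le> (cmod (f x) + cmod (g x))\<^sup>2"
      by (intro power_mono norm_triangle_ineq) auto
    also have "\<dots> \<le> 2 * (cmod (f x))\<^sup>2 + 2 * (cmod (g x))\<^sup>2"
      using sum_squares_bound[of "cmod (f x)" "cmod (g x)"] by (simp add: power2_sum)
    finally show ?thesis .
  qed
qed (use assms in \<open>auto simp: L2_def\<close>)

lemma L2_mult_bounded:
  assumes "f \<in> L2" "m \<in> borel_measurable lebesgue" "\<And>x. cmod (m x) \<le> C"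
  shows "(\<lambda>x. m x * f x) \<in> L2"
proof (rule L2_bound)
  show "integrable lebesgue (\<lambda>x. C\<^sup>2 * (cmod (f x))\<^sup>2)" using assms by (auto simp: L2_def)
  show "(cmod (m x * f x))\<^sup>2 \<le> C\<^sup>2 * (cmod (f x))\<^sup>2" for x
    unfolding norm_mult power_mult_distrib by (intro mult_right_mono power_mono assms) auto
qed (use assms in \<open>auto simp: L2_def\<close>)

lemma L2_scale: "f \<in> L2 \<Longrightarrow> (\<lambda>x. c * f x) \<in> L2"
  by (rule L2_mult_bounded[where C = "cmod c"]) auto

lemma L2_minus: "f \<in> L2 \<Longrightarrow> (\<lambda>x. - f x) \<in> L2"
  using L2_scale[of f "-1"] by simp

lemma L2_diff: "f \<in> L2 \<Longrightarrow> g \<in> L2 \<Longrightarrow> (\<lambda>x. f x - g x) \<in> L2"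
  using L2_add[OF _ L2_minus[of g], of f] by simp

lemma L2_zero: "(\<lambda>x. 0) \<in> L2"
  by (simp add: L2_def)

lemma L2_sum: "(\<And>k. k \<in> S \<Longrightarrow> f k \<in> L2) \<Longrightarrow> (\<lambda>x. \<Sum>k\<in>S. f k x) \<in> L2"
  by (induction S rule: infinite_finite_induct) (auto intro: L2_add L2_zero)

lemma integrable_inner_L2:
  assumes "f \<in> L2" "g \<in> L2" shows "integrable lebesgue (\<lambda>x. f x * cnj (g x))"
proof (rule Bochner_Integration.integrable_bound)
  show "integrable lebesgue (\<lambda>x. (cmod (f x))\<^sup>2 + (cmod (g x))\<^sup>2)" using assms by (auto simp: L2_def)
  show "AE x in lebesgue. norm (f x * cnj (g x)) \<le> norm ((cmod (f x))\<^sup>2 + (cmod (g x))\<^sup>2)"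
  proof (rule AE_I2)
    fix x
    have "2 * (cmod (f x) * cmod (g x)) \<le> (cmod (f x))\<^sup>2 + (cmod (g x))\<^sup>2"
      using sum_squares_bound[of "cmod (f x)" "cmod (g x)"] by simp
    moreover have "0 \<le> cmod (f x) * cmod (g x)" by simp
    ultimately show "norm (f x * cnj (g x)) \<le> norm ((cmod (f x))\<^sup>2 + (cmod (g x))\<^sup>2)"
      unfolding norm_mult complex_mod_cnj real_norm_def by linarith
  qed
  show "(\<lambda>x. f x * cnj (g x)) \<in> borel_measurable lebesgue"
    using assms by (auto simp: L2_def intro!: borel_measurable_times borel_measurable_continuous_on[of cnj] continuous_intros)
qed

lemma norm_L2_power2: "(norm_L2 f)\<^sup>2 = (LINT x|lebesgue. (cmod (f x))\<^sup>2)"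
  by (simp add: norm_L2_def)

lemma norm_L2_nonneg [simp]: "0 \<le> norm_L2 f"
  by (simp add: norm_L2_def)

lemma inner_L2_self: "inner_L2 f f = complex_of_real ((norm_L2 f)\<^sup>2)"
proof -
  have "inner_L2 f f = (LINT x|lebesgue. complex_of_real ((cmod (f x))\<^sup>2))"
    unfolding inner_L2_def by (intro Bochner_Integration.integral_cong) (simp_all only: complex_norm_square)
  thus ?thesis unfolding norm_L2_power2 by (simp only: integral_complex_of_real)
qed

lemma inner_L2_commute: "inner_L2 g f = cnj (inner_L2 f g)"
  by (simp add: inner_L2_def mult.commute flip: Bochner_Integration.integral_cnj)

lemma inner_L2_add_left:
  "f \<in> L2 \<Longrightarrow> g \<in> L2 \<Longrightarrow> h \<in> L2 \<Longrightarrow> inner_L2 (\<lambda>x. f x + g x) h = inner_L2 f h + inner_L2 g h"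
  unfolding inner_L2_def
  by (simp add: distrib_right Bochner_Integration.integral_add integrable_inner_L2)

lemma inner_L2_scale_left: "inner_L2 (\<lambda>x. c * f x) h = c * inner_L2 f h"
  by (simp add: inner_L2_def mult.assoc)

lemma inner_L2_minus_left: "inner_L2 (\<lambda>x. - f x) h = - inner_L2 f h"
  by (simp add: inner_L2_def)

lemma inner_L2_diff_left:
  "f \<in> L2 \<Longrightarrow> g \<in> L2 \<Longrightarrow> h \<in> L2 \<Longrightarrow> inner_L2 (\<lambda>x. f x - g x) h = inner_L2 f h - inner_L2 g h"
  using inner_L2_add_left[of f "\<lambda>x. - g x" h] by (simp add: inner_L2_minus_left L2_minus)

lemma inner_L2_diff_right:
  "f \<in> L2 \<Longrightarrow> g \<in> L2 \<Longrightarrow> h \<in> L2 \<Longrightarrow> inner_L2 h (\<lambda>x. f x - g x) = inner_L2 h f - inner_L2 h g"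
  by (simp add: inner_L2_commute[of h] inner_L2_diff_left)

lemma inner_L2_sum_left:
  assumes "\<And>k. k \<in> S \<Longrightarrow> f k \<in> L2" "h \<in> L2"
  shows "inner_L2 (\<lambda>x. \<Sum>k\<in>S. f k x) h = (\<Sum>k\<in>S. inner_L2 (f k) h)"
  using assms by (simp add: inner_L2_def sum_distrib_right Bochner_Integration.integral_sum integrable_inner_L2)

text \<open>Squares are compared because the inequality for nonnegative integrals has that form. The
  moduli are taken into \<open>ennreal\<close>, where \<open>sq\<close> identifies the integrals of
  squares with norms; integrability of the product allows the return to real numbers.\<close>

lemma Cauchy_Schwarz_L2:
  assumes "f \<in> L2" "g \<in> L2"
  shows "cmod (inner_L2 f g) \<le> norm_L2 f * norm_L2 g"
proof (rule power2_le_imp_le)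
  have [measurable]: "f \<in> borel_measurable lebesgue" "g \<in> borel_measurable lebesgue"
    using assms by (auto simp: L2_def)
  have sq: "(\<integral>\<^sup>+x. (ennreal (cmod (h x)))\<^sup>2 \<partial>lebesgue) = ennreal ((norm_L2 h)\<^sup>2)"
    if "h \<in> L2" for h :: "'a \<Rightarrow> complex"
  proof -
    have "(\<integral>\<^sup>+x. (ennreal (cmod (h x)))\<^sup>2 \<partial>lebesgue) = (\<integral>\<^sup>+x. ennreal ((cmod (h x))\<^sup>2) \<partial>lebesgue)"
      by (simp add: ennreal_power)
    also have "\<dots> = ennreal ((norm_L2 h)\<^sup>2)"
      unfolding norm_L2_power2 by (rule nn_integral_eq_integral) (use that in \<open>auto simp: L2_def\<close>)
    finally show ?thesis .
  qed
  have int: "integrable lebesgue (\<lambda>x. cmod (f x) * cmod (g x))"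
    using integrable_norm[OF integrable_inner_L2[OF assms]] by (simp add: norm_mult)
  have "cmod (inner_L2 f g) \<le> (LINT x|lebesgue. cmod (f x) * cmod (g x))"
    unfolding inner_L2_def
    using integral_norm_bound[of lebesgue "\<lambda>x. f x * cnj (g x)"] by (simp add: norm_mult)
  hence "(cmod (inner_L2 f g))\<^sup>2 \<le> (LINT x|lebesgue. cmod (f x) * cmod (g x))\<^sup>2"
    by (intro power_mono) auto
  also have "\<dots> \<le> (norm_L2 f)\<^sup>2 * (norm_L2 g)\<^sup>2"
  proof -
    have "ennreal ((LINT x|lebesgue. cmod (f x) * cmod (g x))\<^sup>2)
        = (\<integral>\<^sup>+x. ennreal (cmod (f x)) * ennreal (cmod (g x)) \<partial>lebesgue)\<^sup>2"
      by (subst ennreal_power[symmetric])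
         (auto simp: nn_integral_eq_integral[OF int, symmetric] ennreal_mult intro!: integral_nonneg_AE)
    also have "\<dots> \<le> ennreal ((norm_L2 f)\<^sup>2) * ennreal ((norm_L2 g)\<^sup>2)"
      using Cauchy_Schwarz_nn_integral[of "\<lambda>x. ennreal (cmod (f x))" lebesgue "\<lambda>x. ennreal (cmod (g x))"]
      by (simp add: sq assms)
    finally show ?thesis by (simp add: ennreal_mult[symmetric] ennreal_le_iff)
  qed
  finally show "(cmod (inner_L2 f g))\<^sup>2 \<le> (norm_L2 f * norm_L2 g)\<^sup>2"
    by (simp add: power_mult_distrib)
qed simp

lemma norm_L2_add:
  assumes "f \<in> L2" "g \<in> L2"
  shows "norm_L2 (\<lambda>x. f x + g x) \<le> norm_L2 f + norm_L2 g"
proof (rule power2_le_imp_le)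
  let ?s = "\<lambda>x. f x + g x"
  have s: "?s \<in> L2" using assms by (rule L2_add)
  have "complex_of_real ((norm_L2 ?s)\<^sup>2) = inner_L2 f ?s + inner_L2 g ?s"
    using inner_L2_add_left[OF assms s] by (simp add: inner_L2_self)
  also have "inner_L2 f ?s = cnj (inner_L2 f f + inner_L2 g f)"
    using inner_L2_add_left[OF assms assms(1)] inner_L2_commute[of f ?s] by simp
  also have "inner_L2 g ?s = cnj (inner_L2 f g + inner_L2 g g)"
    using inner_L2_add_left[OF assms assms(2)] inner_L2_commute[of g ?s] by simp
  finally have "complex_of_real ((norm_L2 ?s)\<^sup>2)
      = of_real ((norm_L2 f)\<^sup>2 + (norm_L2 g)\<^sup>2) + (inner_L2 f g + cnj (inner_L2 f g))"
    by (simp add: inner_L2_self inner_L2_commute[of g f])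
  hence "(norm_L2 ?s)\<^sup>2 = (norm_L2 f)\<^sup>2 + (norm_L2 g)\<^sup>2 + 2 * Re (inner_L2 f g)"
    by (simp add: complex_eq_iff)
  also have "Re (inner_L2 f g) \<le> norm_L2 f * norm_L2 g"
    using Cauchy_Schwarz_L2[OF assms] complex_Re_le_cmod order_trans by blast
  finally show "(norm_L2 ?s)\<^sup>2 \<le> (norm_L2 f + norm_L2 g)\<^sup>2" by (simp add: power2_sum)
qed simp

lemma norm_L2_scale: "norm_L2 (\<lambda>x. c * f x) = cmod c * norm_L2 f"
  by (simp add: norm_L2_def norm_mult power_mult_distrib real_sqrt_mult)

lemma norm_L2_minus_commute: "norm_L2 (\<lambda>x. f x - g x) = norm_L2 (\<lambda>x. g x - f x)"
  by (simp add: norm_L2_def norm_minus_commute)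

lemma norm_L2_triangle:
  assumes "f \<in> L2" "g \<in> L2" "h \<in> L2"
  shows "norm_L2 (\<lambda>x. f x - h x) \<le> norm_L2 (\<lambda>x. f x - g x) + norm_L2 (\<lambda>x. g x - h x)"
  using norm_L2_add[OF L2_diff[OF assms(1,2)] L2_diff[OF assms(2,3)]] by simp

text \<open>Both arguments vary because the correlation identity pairs two sequences that converge
  together, such as \<open>F n\<close> and its translate.\<close>

lemma inner_L2_tendsto:
  assumes F: "converges_L2 F f" and G: "converges_L2 G g"
  shows "(\<lambda>n. inner_L2 (F n) (G n)) \<longlonglongrightarrow> inner_L2 f g"
proof -
  have L: "F n \<in> L2" "G n \<in> L2" "f \<in> L2" "g \<in> L2" for n
    using assms by (auto simp: converges_L2_def)
  let ?a = "\<lambda>n. norm_L2 (\<lambda>x. F n x - f x)" and ?b = "\<lambda>n. norm_L2 (\<lambda>x. G n x - g x)"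
  have lim: "?a \<longlonglongrightarrow> 0" "?b \<longlonglongrightarrow> 0" using assms by (auto simp: converges_L2_def)
  have "(\<lambda>n. inner_L2 (F n) (G n) - inner_L2 f g) \<longlonglongrightarrow> 0"
  proof (rule Lim_null_comparison)
    show "(\<lambda>n. ?a n * ?b n + ?a n * norm_L2 g + norm_L2 f * ?b n) \<longlonglongrightarrow> 0"
      using tendsto_add[OF tendsto_add[OF tendsto_mult[OF lim] tendsto_mult[OF lim(1) tendsto_const[of "norm_L2 g"]]]
        tendsto_mult[OF tendsto_const[of "norm_L2 f"] lim(2)]] by simp
    show "\<forall>\<^sub>F n in sequentially. cmod (inner_L2 (F n) (G n) - inner_L2 f g)
        \<le> ?a n * ?b n + ?a n * norm_L2 g + norm_L2 f * ?b n"
    proof (rule always_eventually, rule allI)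
      fix n
      let ?u = "\<lambda>x. F n x - f x" and ?v = "\<lambda>x. G n x - g x"
      have uv: "?u \<in> L2" "?v \<in> L2" by (auto intro!: L2_diff L)
      have u: "inner_L2 ?u h = inner_L2 (F n) h - inner_L2 f h" if "h \<in> L2" for h
        by (rule inner_L2_diff_left[OF L(1,3) that])
      have v: "inner_L2 h ?v = inner_L2 h (G n) - inner_L2 h g" if "h \<in> L2" for h
        by (rule inner_L2_diff_right[OF L(2,4) that])
      \<comment> \<open>Every term of this expansion contains one of the errors \<open>?u\<close>,
        \<open>?v\<close>, so Cauchy-Schwarz sends each of them to 0.\<close>
      have D: "inner_L2 (F n) (G n) - inner_L2 f g = inner_L2 ?u ?v + inner_L2 ?u g + inner_L2 f ?v"
        unfolding u[OF uv(2)] u[OF L(4)] v[OF L(1)] v[OF L(3)] by simp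
      show "cmod (inner_L2 (F n) (G n) - inner_L2 f g)
          \<le> ?a n * ?b n + ?a n * norm_L2 g + norm_L2 f * ?b n"
        unfolding D
        by (rule norm_triangle_mono[OF norm_triangle_mono[OF Cauchy_Schwarz_L2[OF uv]
            Cauchy_Schwarz_L2[OF uv(1) L(4)]] Cauchy_Schwarz_L2[OF L(3) uv(2)]])
    qed
  qed
  thus ?thesis by (rule LIM_zero_cancel)
qed

section \<open>Translation invariance of Lebesgue measure and its consequences in L2\<close>

lemma measurable_lebesgue_translation:
  fixes t :: "'a::euclidean_space"
  shows "(\<lambda>x. x - t) \<in> lebesgue \<rightarrow>\<^sub>M lebesgue"
proof -
  \<comment> \<open>Translation appears as the coordinatewise affine map with offset
    \<open>- t\<close> and all factors equal to 1.\<close>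
  have T: "(\<lambda>x. - t + (\<Sum>j\<in>Basis. (1 * (x \<bullet> j)) *\<^sub>R j)) = (\<lambda>x. x - t)"
    by (simp add: euclidean_representation)
  show ?thesis
    by (rule lebesgue_affine_measurable[of "\<lambda>_. 1" "- t", OF one_neq_zero, unfolded T])
qed

text \<open>The Jacobian of a coordinatewise affine map is the product of the moduli of its factors,
  here all 1, so the density disappears.\<close>

lemma lebesgue_distr_translation: "distr lebesgue lebesgue (\<lambda>x. x - t) = (lebesgue :: 'a::euclidean_space measure)"
proof -
  have T: "(\<lambda>x. - t + (\<Sum>j\<in>Basis. (1 * (x \<bullet> j)) *\<^sub>R j)) = (\<lambda>x. x - t)"
    by (simp add: euclidean_representation)
  have one: "(\<lambda>_::'a. ennreal (\<Prod>j\<in>(Basis::'a set). \<bar>1\<bar>)) = (\<lambda>_. 1)"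
    by simp
  show ?thesis
    by (rule lebesgue_affine_euclidean[of "\<lambda>_. 1" "- t", OF one_neq_zero, unfolded T one density_1, symmetric])
qed

lemma lebesgue_integral_translation:
  fixes f :: "'a::euclidean_space \<Rightarrow> 'b::{banach, second_countable_topology}"
  assumes "f \<in> borel_measurable lebesgue"
  shows "(LINT x|lebesgue. f (x - t)) = (LINT x|lebesgue. f x)"
  using integral_distr[OF measurable_lebesgue_translation assms, of t]
  by (simp add: lebesgue_distr_translation)

lemma lebesgue_integrable_translation:
  fixes f :: "'a::euclidean_space \<Rightarrow> 'b::{banach, second_countable_topology}"
  assumes "f \<in> borel_measurable lebesgue" "integrable lebesgue f"
  shows "integrable lebesgue (\<lambda>x. f (x - t))"
  using integrable_distr_eq[OF measurable_lebesgue_translation assms(1), of t] assms(2)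
  by (simp add: lebesgue_distr_translation)

lemma L2_translate: "f \<in> L2 \<Longrightarrow> translate t f \<in> L2"
  using lebesgue_integrable_translation[of "\<lambda>x. (cmod (f x))\<^sup>2" t]
    measurable_compose[OF measurable_lebesgue_translation[of t], of f borel]
  by (auto simp: L2_def translate_def)

lemma norm_L2_translate: "f \<in> L2 \<Longrightarrow> norm_L2 (translate t f) = norm_L2 f"
  using lebesgue_integral_translation[of "\<lambda>x. (cmod (f x))\<^sup>2" t]
  by (auto simp: L2_def norm_L2_def translate_def)

text \<open>Shifting the integration variable by \<open>s\<close> leaves only the difference of the
  two translations. With \<open>f = g\<close>, all Gram entries of a system of translates are thus
  values of a single autocorrelation.\<close>

lemma inner_L2_translate:
  assumes "f \<in> L2" "g \<in> L2"
  shows "inner_L2 (translate s f) (translate t g) = inner_L2 f (translate (t - s) g)"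
  using lebesgue_integral_translation[of "\<lambda>x. f x * cnj (translate (t - s) g x)" s]
    borel_measurable_integrable[OF integrable_inner_L2[OF assms(1) L2_translate[OF assms(2), of "t - s"]]]
  by (simp add: inner_L2_def translate_def algebra_simps)

lemma converges_L2_translate:
  assumes "converges_L2 F f"
  shows "converges_L2 (\<lambda>n. translate t (F n)) (translate t f)"
proof -
  have "norm_L2 (\<lambda>x. translate t (F n) x - translate t f x) = norm_L2 (\<lambda>x. F n x - f x)" for n
    using norm_L2_translate[of "\<lambda>x. F n x - f x" t] assms
    by (simp add: converges_L2_def L2_diff translate_def)
  thus ?thesis using assms by (auto simp: converges_L2_def L2_translate)
qed

text \<open>Multiplication by a unimodular function is an isometry of L2. It is meant for the
  characters \<open>iexp (2 * pi * (a \<bullet> w))\<close>.\<close>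

lemma converges_L2_mult_unimodular:
  assumes "converges_L2 F f" "m \<in> borel_measurable lebesgue" "\<And>x. cmod (m x) = 1"
  shows "converges_L2 (\<lambda>n x. m x * F n x) (\<lambda>x. m x * f x)"
proof -
  have "norm_L2 (\<lambda>x. m x * F n x - m x * f x) = norm_L2 (\<lambda>x. F n x - f x)" for n
    by (simp add: norm_L2_def norm_mult assms(3) flip: right_diff_distrib)
  thus ?thesis using assms by (auto simp: converges_L2_def intro: L2_mult_bounded[where C = 1])
qed

section \<open>Completeness and Schur's test\<close>

lemma nn_integral_L2:
  "f \<in> L2 \<Longrightarrow> (\<integral>\<^sup>+x. ennreal ((cmod (f x))\<^sup>2) \<partial>lebesgue) = ennreal ((norm_L2 f)\<^sup>2)"
  unfolding norm_L2_power2 by (rule nn_integral_eq_integral) (auto simp: L2_def)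

text \<open>The bound concerns the nonnegative integral, whose finiteness proves membership in
  \<open>L2\<close>. A bound on \<open>norm_L2\<close> alone could not, since its integral is 0 when
  the square is not integrable.\<close>

lemma L2_nn_integral_bound:
  assumes [measurable]: "f \<in> borel_measurable lebesgue"
    and b: "(\<integral>\<^sup>+x. ennreal ((cmod (f x))\<^sup>2) \<partial>lebesgue) \<le> ennreal (c\<^sup>2)" and "0 \<le> c"
  shows "f \<in> L2" "norm_L2 f \<le> c"
proof -
  have fin: "(\<integral>\<^sup>+x. ennreal ((cmod (f x))\<^sup>2) \<partial>lebesgue) < \<infinity>"
    using b by (rule le_less_trans) simp
  show f: "f \<in> L2"
    using fin by (auto simp: L2_def integrable_iff_bounded)
  have "ennreal ((norm_L2 f)\<^sup>2) \<le> ennreal (c\<^sup>2)"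
    using b nn_integral_L2[OF f] by simp
  hence "(norm_L2 f)\<^sup>2 \<le> c\<^sup>2" by (simp add: ennreal_le_iff)
  thus "norm_L2 f \<le> c" using \<open>0 \<le> c\<close> by (rule power2_le_imp_le)
qed

text \<open>Fatou's lemma for squared moduli; the limes superior ignores the first \<open>K\<close>
  terms. It puts a pointwise limit into \<open>L2\<close> before any L2 convergence is known, both
  for the limit in \<open>L2_complete\<close> and for the transform in
  \<open>fourier_L1_Plancherel_borel\<close>.\<close>

lemma L2_Fatou:
  assumes V: "\<And>k. V k \<in> L2" "\<And>k. k \<ge> K \<Longrightarrow> norm_L2 (V k) \<le> c"
    and v: "v \<in> borel_measurable lebesgue" "AE x in lebesgue. (\<lambda>k. V k x) \<longlonglongrightarrow> v x" and "0 \<le> c"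
  shows "v \<in> L2" "norm_L2 v \<le> c"
proof -
  have [measurable]: "V k \<in> borel_measurable lebesgue" for k using V by (simp add: L2_def)
  have "(\<integral>\<^sup>+x. ennreal ((cmod (v x))\<^sup>2) \<partial>lebesgue)
      = (\<integral>\<^sup>+x. liminf (\<lambda>k. ennreal ((cmod (V k x))\<^sup>2)) \<partial>lebesgue)"
  proof (rule nn_integral_cong_AE, use v(2) in eventually_elim)
    case (elim x)
    have "(\<lambda>k. ennreal ((cmod (V k x))\<^sup>2)) \<longlonglongrightarrow> ennreal ((cmod (v x))\<^sup>2)"
      by (intro tendsto_ennrealI tendsto_power tendsto_norm elim)
    thus ?case by (intro lim_imp_Liminf[symmetric]) auto
  qed
  also have "\<dots> \<le> liminf (\<lambda>k. \<integral>\<^sup>+x. ennreal ((cmod (V k x))\<^sup>2) \<partial>lebesgue)"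
    by (rule nn_integral_liminf) measurable
  also have "\<dots> \<le> limsup (\<lambda>k. \<integral>\<^sup>+x. ennreal ((cmod (V k x))\<^sup>2) \<partial>lebesgue)"
    by (rule Liminf_le_Limsup) simp
  also have "\<dots> \<le> ennreal (c\<^sup>2)"
  proof (rule Limsup_bounded)
    show "\<forall>\<^sub>F k in sequentially. (\<integral>\<^sup>+x. ennreal ((cmod (V k x))\<^sup>2) \<partial>lebesgue) \<le> ennreal (c\<^sup>2)"
      using eventually_ge_at_top[of K]
      by eventually_elim (auto simp: nn_integral_L2[OF V(1)] intro!: ennreal_leI power_mono V)
  qed
  finally have *: "(\<integral>\<^sup>+x. ennreal ((cmod (v x))\<^sup>2) \<partial>lebesgue) \<le> ennreal (c\<^sup>2)" .
  show "v \<in> L2" "norm_L2 v \<le> c" by (rule L2_nn_integral_bound[OF v(1) * \<open>0 \<le> c\<close>])+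
qed

text \<open>
  Along a rapidly converging subsequence the differences \<open>d k\<close> satisfy \<open>\<Sum>k. 2 ^ k * \<parallel>d k\<parallel>\<^sup>2 < \<infinity>\<close>, hence
  \<open>\<Sum>k. 2 ^ k * \<bar>d k x\<bar>\<^sup>2 < \<infinity>\<close> almost everywhere, which forces \<open>\<Sum>k. \<bar>d k x\<bar> < \<infinity>\<close>.
\<close>

lemma L2_complete:
  assumes U: "\<And>n. U n \<in> L2"
    and Cauchy: "\<And>e. e > 0 \<Longrightarrow> \<exists>N. \<forall>m\<ge>N. \<forall>n\<ge>N. norm_L2 (\<lambda>x. U m x - U n x) \<le> e"
  obtains u where "converges_L2 U u"
proof -
  have "\<forall>k. \<exists>N. \<forall>m\<ge>N. \<forall>n\<ge>N. norm_L2 (\<lambda>x. U m x - U n x) \<le> (1/2) ^ k"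
    by (intro allI Cauchy) simp
  then obtain N where N: "\<And>k m n. m \<ge> N k \<Longrightarrow> n \<ge> N k \<Longrightarrow> norm_L2 (\<lambda>x. U m x - U n x) \<le> (1/2) ^ k"
    by metis
  \<comment> \<open>The sum puts \<open>r k\<close> above \<open>N k\<close> and makes
    \<open>r\<close> nondecreasing; the summand \<open>k\<close> drives \<open>r k\<close> to
    infinity.\<close>
  define r where "r k = k + (\<Sum>i\<le>k. N i)" for k
  have rN: "N k \<le> r k" for k unfolding r_def by (simp add: trans_le_add2 member_le_sum)
  have rSuc: "r k \<le> r (Suc k)" for k by (simp add: r_def)
  have rk: "k \<le> r k" for k by (simp add: r_def)
  have [measurable]: "U n \<in> borel_measurable lebesgue" for n using U by (simp add: L2_def)
  define d where "d k x = U (r (Suc k)) x - U (r k) x" for k x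
  have dL2: "d k \<in> L2" for k unfolding d_def by (intro L2_diff U)
  have [measurable]: "d k \<in> borel_measurable lebesgue" for k using dL2 by (simp add: L2_def)
  have nd: "norm_L2 (d k) \<le> (1/2) ^ k" for k
    unfolding d_def by (rule N) (use rN rSuc order_trans in blast)+
  have "(\<integral>\<^sup>+x. (\<Sum>k. ennreal (2 ^ k * (cmod (d k x))\<^sup>2)) \<partial>lebesgue)
      = (\<Sum>k. \<integral>\<^sup>+x. ennreal (2 ^ k * (cmod (d k x))\<^sup>2) \<partial>lebesgue)"
    by (rule nn_integral_suminf) measurable
  also have "\<dots> \<le> (\<Sum>k. ennreal ((1/2) ^ k))"
  proof (rule suminf_le)
    fix k
    have "(\<integral>\<^sup>+x. ennreal (2 ^ k * (cmod (d k x))\<^sup>2) \<partial>lebesgue) = ennreal (2 ^ k * (norm_L2 (d k))\<^sup>2)"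
      by (simp add: ennreal_mult nn_integral_cmult nn_integral_L2[OF dL2])
    also have "\<dots> \<le> ennreal (2 ^ k * ((1/2) ^ k)\<^sup>2)"
      by (intro ennreal_leI mult_left_mono power_mono nd) auto
    also have "2 ^ k * ((1/2) ^ k)\<^sup>2 = ((1/2) ^ k :: real)"
      by (simp add: power2_eq_square power_one_over)
    finally show "(\<integral>\<^sup>+x. ennreal (2 ^ k * (cmod (d k x))\<^sup>2) \<partial>lebesgue) \<le> ennreal ((1/2) ^ k)" .
  qed auto
  also have "\<dots> = ennreal (1 / (1 - 1 / 2))"
    by (rule suminf_ennreal_eq[OF _ geometric_sums]) auto
  finally have "(\<integral>\<^sup>+x. (\<Sum>k. ennreal (2 ^ k * (cmod (d k x))\<^sup>2)) \<partial>lebesgue) \<noteq> \<infinity>"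
    by (auto simp: top_unique)
  hence "AE x in lebesgue. (\<Sum>k. ennreal (2 ^ k * (cmod (d k x))\<^sup>2)) \<noteq> \<infinity>"
    by (intro nn_integral_PInf_AE) measurable
  hence conv: "AE x in lebesgue. convergent (\<lambda>k. U (r k) x)"
  proof eventually_elim
    case (elim x)
    have s: "summable (\<lambda>k. 2 ^ k * (cmod (d k x))\<^sup>2)"
      by (rule summable_suminf_not_top) (use elim in auto)
    have "summable (\<lambda>k. cmod (d k x))"
    proof (rule summable_comparison_test')
      show "summable (\<lambda>k. 2 ^ k * (cmod (d k x))\<^sup>2 + (1/2) ^ k)"
        by (intro summable_add s summable_geometric) simp
      show "norm (cmod (d k x)) \<le> 2 ^ k * (cmod (d k x))\<^sup>2 + (1/2) ^ k" for k
      proof -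
        let ?a = "cmod (d k x)"
        \<comment> \<open>Expanding this square gives
          \<open>2 * ?a \<le> 2 ^ k * ?a\<^sup>2 + (1/2) ^ k\<close>, a summable bound that is
          linear in \<open>?a\<close>.\<close>
        have "0 \<le> 2 ^ k * (?a - (1/2) ^ k)\<^sup>2" by simp
        also have "\<dots> = 2 ^ k * ?a\<^sup>2 - 2 * ?a + (1/2) ^ k"
          by (simp add: power2_eq_square power_one_over field_simps)
        finally show ?thesis unfolding real_norm_def abs_norm_cancel using norm_ge_zero[of "d k x"] by linarith
      qed
    qed
    hence "summable (\<lambda>k. d k x)" by (rule summable_norm_cancel)
    hence "(\<lambda>m. (\<Sum>k<m. d k x) + U (r 0) x) \<longlonglongrightarrow> (\<Sum>k. d k x) + U (r 0) x"
      by (intro tendsto_add summable_LIMSEQ tendsto_const)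
    moreover have "(\<Sum>k<m. d k x) = U (r m) x - U (r 0) x" for m
      unfolding d_def by (rule sum_lessThan_telescope)
    ultimately show ?case by (auto simp: convergent_def)
  qed
  \<comment> \<open>Where the subsequence diverges, \<open>lim\<close> has some fixed unspecified
    value, so \<open>u\<close> is total and measurable without removing a null set.\<close>
  define u where "u x = lim (\<lambda>k. U (r k) x)" for x
  have um: "u \<in> borel_measurable lebesgue"
    unfolding u_def by measurable
  have lim: "AE x in lebesgue. (\<lambda>k. U (r k) x) \<longlonglongrightarrow> u x"
    using conv unfolding u_def convergent_LIMSEQ_iff .
  \<comment> \<open>Letting \<open>j\<close> tend to infinity in the Cauchy estimate between
    \<open>U n\<close> and \<open>U (r j)\<close>, Fatou keeps the bound. This gives
    \<open>u \<in> L2\<close> and also convergence of the whole sequence, not only of the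
    subsequence.\<close>
  have close: "(\<lambda>x. U n x - u x) \<in> L2" "norm_L2 (\<lambda>x. U n x - u x) \<le> (1/2) ^ k" if "n \<ge> N k" for n k
  proof -
    have 1: "(\<lambda>x. U n x - U (r j) x) \<in> L2" for j by (intro L2_diff U)
    have 2: "norm_L2 (\<lambda>x. U n x - U (r j) x) \<le> (1/2) ^ k" if "j \<ge> N k" for j
      by (rule N[OF \<open>n \<ge> N k\<close>]) (use that rk order_trans in blast)
    have 3: "AE x in lebesgue. (\<lambda>j. U n x - U (r j) x) \<longlonglongrightarrow> U n x - u x"
      using lim by eventually_elim (intro tendsto_diff tendsto_const)
    show "(\<lambda>x. U n x - u x) \<in> L2" "norm_L2 (\<lambda>x. U n x - u x) \<le> (1/2) ^ k"
      using L2_Fatou[of "\<lambda>j x. U n x - U (r j) x" "N k" "(1/2) ^ k" "\<lambda>x. U n x - u x", OF 1 2 _ 3] um by auto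
  qed
  have "u \<in> L2"
    using L2_diff[OF U[of "N 0"] close(1)[of 0 "N 0"]] by simp
  moreover have "(\<lambda>n. norm_L2 (\<lambda>x. U n x - u x)) \<longlonglongrightarrow> 0"
  proof (rule LIMSEQ_I)
    fix e :: real assume "e > 0"
    then obtain k where "(1/2) ^ k < e" using real_arch_pow_inv[of e "1/2"] by auto
    thus "\<exists>N. \<forall>n\<ge>N. norm (norm_L2 (\<lambda>x. U n x - u x) - 0) < e"
      using close(2)[of k] by (intro exI[of _ "N k"]) (auto intro: le_less_trans)
  qed
  ultimately show ?thesis using U that by (auto simp: converges_L2_def)
qed

text \<open>The bound follows by expanding \<open>\<parallel>f - s \<Sum>k. c k \<psi> k\<parallel>\<^sup>2 \<ge> 0\<close> with \<open>c k = \<langle>f, \<psi> k\<rangle>\<close> at \<open>s = 1 / M\<close>.\<close>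

lemma Schur_Bessel_finite:
  assumes \<psi>: "\<And>k. \<psi> k \<in> L2" and f: "f \<in> L2" and "finite S" and "M > 0"
    and row: "\<And>k. k \<in> S \<Longrightarrow> (\<Sum>l\<in>S. cmod (inner_L2 (\<psi> k) (\<psi> l))) \<le> M"
  shows "(\<Sum>k\<in>S. (cmod (inner_L2 f (\<psi> k)))\<^sup>2) \<le> M * (norm_L2 f)\<^sup>2"
proof -
  define c where "c k = inner_L2 f (\<psi> k)" for k
  define C where "C = (\<Sum>k\<in>S. (cmod (c k))\<^sup>2)"
  define g where "g x = (\<Sum>k\<in>S. c k * \<psi> k x)" for x
  have g: "g \<in> L2" unfolding g_def by (intro L2_sum L2_scale \<psi>)
  have gf: "inner_L2 g f = of_real C"
  proof -
    have "inner_L2 g f = (\<Sum>k\<in>S. c k * inner_L2 (\<psi> k) f)"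
      unfolding g_def using \<psi> f by (subst inner_L2_sum_left) (auto intro: L2_scale simp: inner_L2_scale_left)
    also have "\<dots> = (\<Sum>k\<in>S. c k * cnj (c k))"
      by (simp add: c_def inner_L2_commute[of _ f])
    finally show ?thesis by (simp add: C_def complex_norm_square[symmetric])
  qed
  have gg: "(norm_L2 g)\<^sup>2 \<le> M * C"
  proof -
    have sym: "cmod (inner_L2 (\<psi> k) (\<psi> l)) = cmod (inner_L2 (\<psi> l) (\<psi> k))" for k l
      by (subst inner_L2_commute) simp
    have gl: "inner_L2 g (\<psi> l) = (\<Sum>k\<in>S. c k * inner_L2 (\<psi> k) (\<psi> l))" for l
      unfolding g_def using \<psi> by (subst inner_L2_sum_left) (auto intro: L2_scale simp: inner_L2_scale_left)
    have "inner_L2 g g = (\<Sum>l\<in>S. c l * inner_L2 (\<psi> l) g)"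
      unfolding g_def[abs_def] using \<psi> g[unfolded g_def[abs_def]]
      by (subst inner_L2_sum_left) (auto intro: L2_scale simp: inner_L2_scale_left)
    also have "\<dots> = (\<Sum>l\<in>S. \<Sum>k\<in>S. c l * cnj (c k) * cnj (inner_L2 (\<psi> k) (\<psi> l)))"
      by (simp add: inner_L2_commute[of _ g] gl sum_distrib_left mult.assoc)
    finally have "(norm_L2 g)\<^sup>2 = cmod (\<Sum>l\<in>S. \<Sum>k\<in>S. c l * cnj (c k) * cnj (inner_L2 (\<psi> k) (\<psi> l)))"
      by (simp add: inner_L2_self) (metis abs_norm_cancel norm_of_real norm_power of_real_power abs_power2)
    also have "\<dots> \<le> (\<Sum>l\<in>S. \<Sum>k\<in>S. cmod (c l) * cmod (c k) * cmod (inner_L2 (\<psi> k) (\<psi> l)))"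
      by (intro order_trans[OF norm_sum] sum_mono) (simp add: norm_mult)
    \<comment> \<open>The arithmetic-geometric mean inequality separates \<open>c l\<close> from
      \<open>c k\<close>. By the symmetry \<open>sym\<close> of the moduli and an exchange of the
      sums, the two halves agree, and only row sums remain.\<close>
    also have "\<dots> \<le> (\<Sum>l\<in>S. \<Sum>k\<in>S. ((cmod (c l))\<^sup>2 / 2 + (cmod (c k))\<^sup>2 / 2) * cmod (inner_L2 (\<psi> k) (\<psi> l)))"
    proof (intro sum_mono mult_right_mono)
      fix l k show "cmod (c l) * cmod (c k) \<le> (cmod (c l))\<^sup>2 / 2 + (cmod (c k))\<^sup>2 / 2"
        using sum_squares_bound[of "cmod (c l)" "cmod (c k)"] by (simp add: field_simps)
    qed simp
    also have "\<dots> = (\<Sum>l\<in>S. \<Sum>k\<in>S. (cmod (c l))\<^sup>2 / 2 * cmod (inner_L2 (\<psi> k) (\<psi> l)))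
        + (\<Sum>l\<in>S. \<Sum>k\<in>S. (cmod (c k))\<^sup>2 / 2 * cmod (inner_L2 (\<psi> k) (\<psi> l)))"
      by (simp add: distrib_right sum.distrib)
    also have "(\<Sum>l\<in>S. \<Sum>k\<in>S. (cmod (c k))\<^sup>2 / 2 * cmod (inner_L2 (\<psi> k) (\<psi> l)))
        = (\<Sum>l\<in>S. \<Sum>k\<in>S. (cmod (c l))\<^sup>2 / 2 * cmod (inner_L2 (\<psi> k) (\<psi> l)))"
      by (subst sum.swap, subst sym) (rule refl)
    also have "(\<Sum>l\<in>S. \<Sum>k\<in>S. (cmod (c l))\<^sup>2 / 2 * cmod (inner_L2 (\<psi> k) (\<psi> l))) + \<dots>
        = (\<Sum>l\<in>S. (cmod (c l))\<^sup>2 * (\<Sum>k\<in>S. cmod (inner_L2 (\<psi> l) (\<psi> k))))"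
      by (subst (1 2) sym) (simp add: sum_distrib_left mult.commute flip: sum.distrib)
    also have "\<dots> \<le> (\<Sum>l\<in>S. (cmod (c l))\<^sup>2 * M)"
      by (intro sum_mono mult_left_mono row) auto
    finally show ?thesis by (simp add: C_def sum_distrib_left mult.commute)
  qed
  \<comment> \<open>The value \<open>1 / M\<close> minimizes
    \<open>- 2 * s * C + s\<^sup>2 * M * C\<close>, the change in the squared norm after inserting
    the bound \<open>gg\<close>.\<close>
  define s where "s = complex_of_real (1 / M)"
  have sg: "(\<lambda>x. s * g x) \<in> L2" by (intro L2_scale g)
  have sgf: "inner_L2 (\<lambda>x. s * g x) f = of_real (C / M)"
    unfolding inner_L2_scale_left gf s_def by simp
  have fsg: "inner_L2 f (\<lambda>x. s * g x) = of_real (C / M)"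
    by (subst inner_L2_commute, subst sgf) simp
  have sgsg: "inner_L2 (\<lambda>x. s * g x) (\<lambda>x. s * g x) = of_real ((norm_L2 g)\<^sup>2 / M\<^sup>2)"
    unfolding inner_L2_self norm_L2_scale s_def using \<open>M > 0\<close> by (simp add: power_mult_distrib power_divide norm_divide)
  have "complex_of_real ((norm_L2 (\<lambda>x. f x - s * g x))\<^sup>2)
      = inner_L2 f f - inner_L2 f (\<lambda>x. s * g x)
        - (inner_L2 (\<lambda>x. s * g x) f - inner_L2 (\<lambda>x. s * g x) (\<lambda>x. s * g x))"
    unfolding inner_L2_self[symmetric] inner_L2_diff_left[OF f sg L2_diff[OF f sg]]
      inner_L2_diff_right[OF f sg f] inner_L2_diff_right[OF f sg sg] ..
  also have "\<dots> = of_real ((norm_L2 f)\<^sup>2 - 2 * C / M + (norm_L2 g)\<^sup>2 / M\<^sup>2)"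
    unfolding fsg sgf sgsg inner_L2_self by (simp add: algebra_simps)
  finally have "(norm_L2 (\<lambda>x. f x - s * g x))\<^sup>2 = (norm_L2 f)\<^sup>2 - 2 * C / M + (norm_L2 g)\<^sup>2 / M\<^sup>2"
    by (simp only: of_real_eq_iff)
  moreover have "(norm_L2 g)\<^sup>2 / M\<^sup>2 \<le> C / M"
    using gg \<open>M > 0\<close> by (simp add: field_simps power2_eq_square)
  moreover have "0 \<le> (norm_L2 (\<lambda>x. f x - s * g x))\<^sup>2" by simp
  ultimately have "C / M \<le> (norm_L2 f)\<^sup>2" by linarith
  thus ?thesis using \<open>M > 0\<close> by (simp add: C_def c_def field_simps)
qed

section \<open>Continuity of correlations\<close>

lemma continuous_imp_measurable_lebesgue:
  fixes f :: "'a::euclidean_space \<Rightarrow> complex"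
  shows "continuous_on UNIV f \<Longrightarrow> f \<in> borel_measurable lebesgue"
  by (intro measurable_completion) (simp add: borel_measurable_continuous_onI)

text \<open>The limit inherits the bound \<open>b\<close> almost everywhere, so the squared
  differences are dominated by \<open>4 * (b x)\<^sup>2\<close>. This turns pointwise convergence of
  truncations into L2 convergence.\<close>

lemma L2_dominated_convergence:
  assumes V: "\<And>n. V n \<in> borel_measurable lebesgue" and v: "v \<in> borel_measurable lebesgue"
    and b: "integrable lebesgue (\<lambda>x. (b x)\<^sup>2)" "\<And>n x. cmod (V n x) \<le> b x"
    and lim: "AE x in lebesgue. (\<lambda>n. V n x) \<longlonglongrightarrow> v x"
  shows "converges_L2 V v"
proof -
  note [measurable] = V v
  have b0: "0 \<le> b x" for x using b(2)[of 0 x] norm_ge_zero order_trans by blast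
  have VL2: "V n \<in> L2" for n
    by (rule L2_bound[OF V b(1)]) (intro power_mono b norm_ge_zero)
  have vb: "AE x in lebesgue. cmod (v x) \<le> b x"
    using lim
  proof eventually_elim
    case (elim x)
    show ?case by (rule LIMSEQ_le_const2[OF tendsto_norm[OF elim]]) (auto intro: b)
  qed
  have vL2: "v \<in> L2"
    unfolding L2_def
  proof (intro CollectI conjI v Bochner_Integration.integrable_bound[OF b(1)])
    show "AE x in lebesgue. norm ((cmod (v x))\<^sup>2) \<le> norm ((b x)\<^sup>2)"
      using vb by eventually_elim (auto intro: power_mono)
  qed measurable
  have "(\<lambda>n. LINT x|lebesgue. (cmod (V n x - v x))\<^sup>2) \<longlonglongrightarrow> (LINT x::'a|lebesgue. 0 :: real)"
  proof (rule integral_dominated_convergence[where w = "\<lambda>x. 4 * (b x)\<^sup>2"])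
    show "integrable lebesgue (\<lambda>x. 4 * (b x)\<^sup>2)" using b by simp
    show "AE x in lebesgue. (\<lambda>n. (cmod (V n x - v x))\<^sup>2) \<longlonglongrightarrow> 0"
      using lim by eventually_elim (auto intro!: tendsto_eq_intros)
    show "AE x in lebesgue. norm ((cmod (V n x - v x))\<^sup>2) \<le> 4 * (b x)\<^sup>2" for n
      using vb
    proof eventually_elim
      case (elim x)
      have "cmod (V n x - v x) \<le> 2 * b x"
        using norm_triangle_ineq4[of "V n x" "v x"] elim b(2)[of n x] by linarith
      hence "(cmod (V n x - v x))\<^sup>2 \<le> (2 * b x)\<^sup>2" by (intro power_mono) auto
      thus ?case by (simp add: power_mult_distrib)
    qed
  qed measurable
  hence "(\<lambda>n. sqrt (LINT x|lebesgue. (cmod (V n x - v x))\<^sup>2)) \<longlonglongrightarrow> sqrt 0"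
    by (intro tendsto_real_sqrt) simp
  thus ?thesis using VL2 vL2 by (simp add: converges_L2_def norm_L2_def)
qed

definition clamp_modulus :: "real \<Rightarrow> complex \<Rightarrow> complex" where
  "clamp_modulus M z = z / of_real (max 1 (cmod z / M))"

text \<open>For \<open>M > 0\<close>, \<open>clamp_modulus M\<close> is the radial retraction of the
  plane onto the disc of radius \<open>M\<close>. The cutoff plays the same part in space: it is 1
  on the ball of radius \<open>M\<close>, 0 outside the ball of radius \<open>M + 1\<close> (for
  \<open>M \<ge> 0\<close>), and linear in the norm between them. Unlike an indicator it preserves
  continuity.\<close>

definition cutoff :: "real \<Rightarrow> 'a::euclidean_space \<Rightarrow> complex" where
  "cutoff M x = of_real (max 0 (min 1 (M + 1 - norm x)))"

lemma continuous_clamp_modulus: "M > 0 \<Longrightarrow> continuous_on UNIV (clamp_modulus M)"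
  unfolding clamp_modulus_def[abs_def] by (intro continuous_intros) auto

lemma continuous_cutoff: "continuous_on UNIV (cutoff M)"
  unfolding cutoff_def[abs_def] by (intro continuous_intros)

lemma clamp_modulus_le:
  assumes "M > 0" shows "cmod (clamp_modulus M z) \<le> M" "cmod (clamp_modulus M z) \<le> cmod z"
proof -
  have m: "cmod (clamp_modulus M z) = cmod z / max 1 (cmod z / M)"
    by (simp add: clamp_modulus_def norm_divide)
  show "cmod (clamp_modulus M z) \<le> M"
    unfolding m using assms by (auto simp: max_def field_simps)
  show "cmod (clamp_modulus M z) \<le> cmod z"
    unfolding m using assms by (auto simp: max_def field_simps)
qed

lemma clamp_modulus_eq: "M > 0 \<Longrightarrow> cmod z \<le> M \<Longrightarrow> clamp_modulus M z = z"
  by (simp add: clamp_modulus_def max_def field_simps)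

lemma cutoff_le: "cmod (cutoff M x) \<le> 1" "cmod (cutoff M x) \<le> indicator (cball 0 (M + 1)) x"
  by (auto simp: cutoff_def indicator_def)

lemma cutoff_eq: "norm x \<le> M \<Longrightarrow> cutoff M x = 1"
  by (simp add: cutoff_def)

text \<open>First \<open>h\<close> is truncated in space and in modulus to \<open>V m\<close>. The
  same truncation is then applied to continuous functions converging to \<open>h\<close> almost
  everywhere. It gives them a common square-integrable bound, so they converge to \<open>V m\<close>
  in L2.\<close>

lemma L2_approx_bounded_continuous:
  assumes h: "h \<in> L2" and "e > 0"
  obtains H C where "H \<in> L2" "continuous_on UNIV H" "\<And>x. cmod (H x) \<le> C"
    "norm_L2 (\<lambda>x. H x - h x) < e"
proof -
  have hm [measurable]: "h \<in> borel_measurable lebesgue" using h by (rule L2_measurable)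
  let ?M = "\<lambda>m::nat. real m + 1"
  define V where "V m x = cutoff (?M m) x * clamp_modulus (?M m) (h x)" for m x
  have cut [measurable]: "cutoff M \<in> borel_measurable lebesgue" for M :: real
    by (rule continuous_imp_measurable_lebesgue[OF continuous_cutoff])
  have cl [measurable]: "clamp_modulus (?M m) \<in> borel_measurable borel" for m
    by (intro borel_measurable_continuous_onI continuous_clamp_modulus) simp
  have Vm [measurable]: "V m \<in> borel_measurable lebesgue" for m unfolding V_def by measurable
  have "converges_L2 V h"
  proof (rule L2_dominated_convergence[where b = "\<lambda>x. cmod (h x)"])
    show "integrable lebesgue (\<lambda>x. (cmod (h x))\<^sup>2)" using h by (simp add: L2_def)
    show "cmod (V n x) \<le> cmod (h x)" for n x
      unfolding V_def norm_mult
      using mult_mono[OF cutoff_le(1)[of "?M n" x] clamp_modulus_le(2)[of "?M n" "h x"]] by simp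
    show "AE x in lebesgue. (\<lambda>n. V n x) \<longlonglongrightarrow> h x"
    proof (rule AE_I2, rule tendsto_eventually)
      fix x
      show "\<forall>\<^sub>F n in sequentially. V n x = h x"
        using eventually_ge_at_top[of "nat \<lceil>max (norm x) (cmod (h x))\<rceil>"]
      proof eventually_elim
        case (elim n)
        hence "max (norm x) (cmod (h x)) \<le> real n" by linarith
        thus ?case by (simp add: V_def cutoff_eq clamp_modulus_eq)
      qed
    qed
  qed measurable
  hence VL2: "V m \<in> L2" and lim: "(\<lambda>m. norm_L2 (\<lambda>x. V m x - h x)) \<longlonglongrightarrow> 0" for m
    by (auto simp: converges_L2_def)
  obtain m where m: "norm_L2 (\<lambda>x. V m x - h x) < e / 2"
    using order_tendstoD(2)[OF lim, of "e / 2"] \<open>e > 0\<close> by (auto simp: eventually_sequentially)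
  \<comment> \<open>This supplies continuous functions \<open>g n\<close> converging to
    \<open>h\<close> off a negligible set, but with no control of their size.\<close>
  have "h measurable_on UNIV"
    using hm by (intro lebesgue_measurable_imp_measurable_on) auto
  then obtain N g where N: "negligible N" and g: "\<And>n. continuous_on UNIV (g n)"
    and gh: "\<And>x. x \<notin> N \<Longrightarrow> (\<lambda>n. g n x) \<longlonglongrightarrow> h x"
    unfolding measurable_on_def by auto
  define W where "W n x = cutoff (?M m) x * clamp_modulus (?M m) (g n x)" for n x
  have Wc: "continuous_on UNIV (W n)" for n
    unfolding W_def
    by (intro continuous_intros continuous_cutoff continuous_on_compose2[OF continuous_clamp_modulus g]) auto
  have Wb: "cmod (W n x) \<le> ?M m * indicator (cball 0 (?M m + 1)) x" for n x
    unfolding W_def norm_mult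
    using mult_mono[OF cutoff_le(2)[of "?M m" x] clamp_modulus_le(1)[of "?M m" "g n x"]] by (simp add: mult.commute)
  have "converges_L2 W (V m)"
  proof (rule L2_dominated_convergence[where b = "\<lambda>x. ?M m * indicator (cball 0 (?M m + 1)) x"])
    show "W n \<in> borel_measurable lebesgue" for n
      by (rule continuous_imp_measurable_lebesgue[OF Wc])
    have "integrable lebesgue (\<lambda>x::'a. (?M m)\<^sup>2 * indicat_real (cball 0 (?M m + 1)) x)"
      by (intro integrable_mult_right integrable_real_indicator) (auto intro: emeasure_bounded_finite[simplified])
    moreover have "(?M m * indicator (cball 0 (?M m + 1)) x)\<^sup>2 = (?M m)\<^sup>2 * indicat_real (cball 0 (?M m + 1)) x"
      for x :: 'a
      by (simp add: indicator_def)
    ultimately show "integrable lebesgue (\<lambda>x::'a. (?M m * indicator (cball 0 (?M m + 1)) x)\<^sup>2)"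
      by simp
    have "AE x in lebesgue. x \<notin> N"
      using N by (simp add: negligible_iff_null_sets AE_not_in)
    thus "AE x in lebesgue. (\<lambda>n. W n x) \<longlonglongrightarrow> V m x"
    proof eventually_elim
      case (elim x)
      have "isCont (clamp_modulus (?M m)) (h x)"
        using continuous_clamp_modulus[of "?M m"] by (simp add: continuous_on_eq_continuous_at)
      thus ?case
        unfolding W_def V_def by (intro tendsto_mult tendsto_const isCont_tendsto_compose[OF _ gh[OF elim]])
    qed
  qed (use Wb in auto)
  hence WL2: "W n \<in> L2" and lim: "(\<lambda>n. norm_L2 (\<lambda>x. W n x - V m x)) \<longlonglongrightarrow> 0" for n
    by (auto simp: converges_L2_def)
  obtain n where n: "norm_L2 (\<lambda>x. W n x - V m x) < e / 2"
    using order_tendstoD(2)[OF lim, of "e / 2"] \<open>e > 0\<close> by (auto simp: eventually_sequentially)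
  show ?thesis
  proof (rule that[of "W n" "?M m"])
    show "cmod (W n x) \<le> ?M m" for x
      by (rule order_trans[OF Wb]) (simp add: indicator_def)
    show "norm_L2 (\<lambda>x. W n x - h x) < e"
      using norm_L2_triangle[OF WL2[of n] VL2[of m] h] m n by linarith
  qed (rule WL2 Wc)+
qed

text \<open>For a bounded continuous \<open>H n\<close> in place of \<open>h\<close>, continuity
  follows by dominated convergence, with a multiple of \<open>cmod (f x)\<close> as bound.
  Translations preserve the norm, so by Cauchy-Schwarz the error of replacing \<open>h\<close> is
  uniform in \<open>t\<close>, and a uniform limit of continuous functions is continuous.\<close>

lemma continuous_on_correlation:
  assumes f: "f \<in> L2" "integrable lebesgue f" and h: "h \<in> L2"
  shows "continuous_on UNIV (\<lambda>t. inner_L2 f (translate t h))"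
proof -
  have "\<forall>n. \<exists>H C. H \<in> L2 \<and> continuous_on UNIV H \<and> (\<forall>x. cmod (H x) \<le> C) \<and>
      norm_L2 (\<lambda>x. H x - h x) < 1 / (real n + 1)"
  proof
    fix n :: nat
    have "1 / (real n + 1) > 0" by simp
    from L2_approx_bounded_continuous[OF h this]
    show "\<exists>H C. H \<in> L2 \<and> continuous_on UNIV H \<and> (\<forall>x. cmod (H x) \<le> C) \<and>
      norm_L2 (\<lambda>x. H x - h x) < 1 / (real n + 1)" by metis
  qed
  then obtain H C where HL2: "\<And>n. H n \<in> L2" and Hc: "\<And>n. continuous_on UNIV (H n)"
    and HC: "\<And>n x. cmod (H n x) \<le> C n" and Hn: "\<And>n. norm_L2 (\<lambda>x. H n x - h x) < 1 / (real n + 1)"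
    by metis
  show ?thesis
  proof (rule uniform_limit_theorem[where F = sequentially])
    show "\<forall>\<^sub>F n in sequentially. continuous_on UNIV (\<lambda>t. inner_L2 f (translate t (H n)))"
    proof (intro always_eventually allI continuous_on_sequentiallyI)
      fix n :: nat and u :: "nat \<Rightarrow> 'a" and a
      assume u: "u \<longlonglongrightarrow> a"
      show "(\<lambda>k. inner_L2 f (translate (u k) (H n))) \<longlonglongrightarrow> inner_L2 f (translate a (H n))"
        unfolding inner_L2_def
      proof (rule integral_dominated_convergence)
        show "integrable lebesgue (\<lambda>x. cmod (f x) * C n)" using f(2) by simp
        show "AE x in lebesgue. (\<lambda>k. f x * cnj (translate (u k) (H n) x)) \<longlonglongrightarrow> f x * cnj (translate a (H n) x)"
        proof (rule AE_I2)
          fix x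
          have "isCont (H n) (x - a)" using Hc[of n] by (simp add: continuous_on_eq_continuous_at)
          thus "(\<lambda>k. f x * cnj (translate (u k) (H n) x)) \<longlonglongrightarrow> f x * cnj (translate a (H n) x)"
            unfolding translate_def
            by (intro tendsto_mult tendsto_cnj tendsto_const isCont_tendsto_compose[where g = "H n"] tendsto_diff u)
        qed
        show "AE x in lebesgue. norm (f x * cnj (translate (u k) (H n) x)) \<le> cmod (f x) * C n" for k
          by (simp add: norm_mult translate_def mult_left_mono HC)
        show "(\<lambda>x. f x * cnj (translate (u k) (H n) x)) \<in> borel_measurable lebesgue" for k
          by (rule borel_measurable_integrable[OF integrable_inner_L2[OF f(1) L2_translate[OF HL2]]])
        show "(\<lambda>x. f x * cnj (translate a (H n) x)) \<in> borel_measurable lebesgue"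
          by (rule borel_measurable_integrable[OF integrable_inner_L2[OF f(1) L2_translate[OF HL2]]])
      qed
    qed
    show "uniform_limit UNIV (\<lambda>n t. inner_L2 f (translate t (H n))) (\<lambda>t. inner_L2 f (translate t h)) sequentially"
    proof (rule uniform_limitI)
      fix e :: real assume "e > 0"
      have "(\<lambda>n. norm_L2 f * (1 / (real n + 1))) \<longlonglongrightarrow> norm_L2 f * 0"
        by (intro tendsto_mult tendsto_const) real_asymp
      hence "\<forall>\<^sub>F n in sequentially. norm_L2 f * (1 / (real n + 1)) < e"
        using \<open>e > 0\<close> by (intro order_tendstoD(2)) auto
      thus "\<forall>\<^sub>F n in sequentially. \<forall>t\<in>UNIV. dist (inner_L2 f (translate t (H n))) (inner_L2 f (translate t h)) < e"
      proof eventually_elim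
        case (elim n)
        show ?case
        proof
          fix t
          have d: "(\<lambda>x. H n x - h x) \<in> L2" by (intro L2_diff HL2 h)
          have "inner_L2 f (translate t (H n)) - inner_L2 f (translate t h)
              = inner_L2 f (translate t (\<lambda>x. H n x - h x))"
            using inner_L2_diff_right[OF L2_translate[OF HL2[of n]] L2_translate[OF h] f(1), of t t]
            by (simp add: translate_def)
          hence "dist (inner_L2 f (translate t (H n))) (inner_L2 f (translate t h))
              \<le> norm_L2 f * norm_L2 (\<lambda>x. H n x - h x)"
            using Cauchy_Schwarz_L2[OF f(1) L2_translate[OF d], of t] by (simp add: dist_norm norm_L2_translate[OF d])
          also have "\<dots> \<le> norm_L2 f * (1 / (real n + 1))"
            using Hn[of n] by (intro mult_left_mono) auto
          finally show "dist (inner_L2 f (translate t (H n))) (inner_L2 f (translate t h)) < e"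
            using elim by linarith
        qed
      qed
    qed
  qed simp
qed

section \<open>The Gaussian and its Fourier transform\<close>

text \<open>\<open>lborel\<close> is the image of the product of one-dimensional Lebesgue measures
  under the map \<open>?T\<close> from coordinates to vectors, so Fubini for finite products
  applies.\<close>

lemma lborel_integral_prod_Basis:
  fixes u :: "'a::euclidean_space \<Rightarrow> real \<Rightarrow> complex"
  assumes u: "\<And>b. b \<in> Basis \<Longrightarrow> integrable lborel (u b)"
  shows "integrable lborel (\<lambda>x::'a. \<Prod>b\<in>Basis. u b (x \<bullet> b))"
    and "(LINT x|lborel. (\<Prod>b\<in>Basis. u b ((x::'a) \<bullet> b))) = (\<Prod>b\<in>Basis. LINT y|lborel. u b y)"
proof -
  interpret product_sigma_finite "\<lambda>_::'a. lborel :: real measure" ..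
  let ?P = "\<Pi>\<^sub>M b\<in>(Basis::'a set). (lborel :: real measure)"
  let ?T = "\<lambda>f. \<Sum>b\<in>(Basis::'a set). f b *\<^sub>R b"
  have T: "?T \<in> ?P \<rightarrow>\<^sub>M borel" by measurable
  have um: "u b \<in> borel_measurable borel" if "b \<in> Basis" for b
    using borel_measurable_integrable[OF u[OF that]] by simp
  have m: "(\<lambda>x::'a. \<Prod>b\<in>Basis. u b (x \<bullet> b)) \<in> borel_measurable borel"
    by (intro borel_measurable_prod measurable_compose[OF _ um]) auto
  have eq: "(\<Prod>b\<in>Basis. u b (?T f \<bullet> b)) = (\<Prod>b\<in>Basis. u b (f b))" for f
    by (intro prod.cong refl) simp
  have *: "lborel = distr ?P borel ?T" by (rule lborel_eq)
  show "integrable lborel (\<lambda>x::'a. \<Prod>b\<in>Basis. u b (x \<bullet> b))"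
    unfolding * by (subst integrable_distr_eq[OF T m], unfold eq) (intro product_integrable_prod u finite_Basis)
  have "(LINT x|lborel. (\<Prod>b\<in>Basis. u b ((x::'a) \<bullet> b))) = (LINT f|?P. (\<Prod>b\<in>Basis. u b (f b)))"
    by (subst *, subst integral_distr[OF T m], unfold eq) (rule refl)
  also have "\<dots> = (\<Prod>b\<in>Basis. LINT y|lborel. u b y)"
    by (intro product_integral_prod u finite_Basis)
  finally show "(LINT x|lborel. (\<Prod>b\<in>Basis. u b ((x::'a) \<bullet> b))) = (\<Prod>b\<in>Basis. LINT y|lborel. u b y)" .
qed

text \<open>Change of variables, needed for the reflection \<open>c = -1\<close> and for the
  dilations by \<open>2 * pi * \<epsilon>\<close> and \<open>- \<epsilon>\<close>.\<close>

lemma lborel_affine_integral: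
  fixes f :: "'a::euclidean_space \<Rightarrow> 'b::{banach, second_countable_topology}"
  assumes [measurable]: "f \<in> borel_measurable borel" and "c \<noteq> 0"
  shows "(LINT x|lborel. f x) = \<bar>c\<bar> ^ DIM('a) *\<^sub>R (LINT x|lborel. f (t + c *\<^sub>R x))"
    and "integrable lborel f \<Longrightarrow> integrable lborel (\<lambda>x. f (t + c *\<^sub>R x))"
proof -
  note * = lborel_affine[OF \<open>c \<noteq> 0\<close>, of t]
  show "(LINT x|lborel. f x) = \<bar>c\<bar> ^ DIM('a) *\<^sub>R (LINT x|lborel. f (t + c *\<^sub>R x))"
    by (subst *) (simp add: integral_density integral_distr)
  assume "integrable lborel f"
  hence "integrable lborel (\<lambda>x. \<bar>c\<bar> ^ DIM('a) *\<^sub>R f (t + c *\<^sub>R x))"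
    by (subst (asm) *) (simp add: integrable_density integrable_distr_eq)
  from integrable_scaleR_right[of "inverse (\<bar>c\<bar> ^ DIM('a))", OF this]
  show "integrable lborel (\<lambda>x. f (t + c *\<^sub>R x))" using \<open>c \<noteq> 0\<close> by simp
qed

text \<open>The scaling is that of the standard normal density without its constant, so that the
  characteristic function of the normal distribution gives the transform. It is not the Gaussian
  fixed by the Fourier transform, whence the powers of \<open>sqrt (2 * pi)\<close> later
  on.\<close>

definition gauss :: "'a::euclidean_space \<Rightarrow> real" where
  "gauss x = exp (- (norm x)\<^sup>2 / 2)"

lemma gauss_measurable [measurable]: "gauss \<in> borel_measurable borel"
  unfolding gauss_def[abs_def] by measurable

lemma gauss_pos: "0 < gauss x"
  by (simp add: gauss_def)

lemma gauss_le_1: "gauss x \<le> 1"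
  by (simp add: gauss_def)

text \<open>Up to the factor \<open>sqrt (2 * pi)\<close> this is the characteristic function of the
  standard normal distribution.\<close>

lemma integral_gauss_real:
  "integrable lborel (\<lambda>x. exp (- x\<^sup>2 / 2) *\<^sub>R iexp (s * x))"
  "(LINT x|lborel. exp (- x\<^sup>2 / 2) *\<^sub>R iexp (s * x)) = of_real (sqrt (2 * pi) * exp (- s\<^sup>2 / 2))"
proof -
  have e: "exp (- x\<^sup>2 / 2) = sqrt (2 * pi) * std_normal_density x" for x :: real
    by (simp add: std_normal_density_def)
  show "integrable lborel (\<lambda>x. exp (- x\<^sup>2 / 2) *\<^sub>R iexp (s * x))"
  proof (rule Bochner_Integration.integrable_bound)
    show "integrable lborel (\<lambda>x. sqrt (2 * pi) * std_normal_density x)" by simp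
    show "AE x in lborel. norm (exp (- x\<^sup>2 / 2) *\<^sub>R iexp (s * x)) \<le> norm (sqrt (2 * pi) * std_normal_density x)"
      unfolding e by (simp add: abs_mult)
  qed measurable
  have "(LINT x|lborel. std_normal_density x *\<^sub>R iexp (s * x)) = of_real (exp (- s\<^sup>2 / 2))"
    using fun_cong[OF char_std_normal_distribution, of s] unfolding char_def
    by (subst (asm) integral_density) auto
  hence "(LINT x|lborel. sqrt (2 * pi) *\<^sub>R (std_normal_density x *\<^sub>R iexp (s * x)))
      = of_real (sqrt (2 * pi) * exp (- s\<^sup>2 / 2))"
    unfolding integral_scaleR_right by (simp only:) (simp only: scaleR_conv_of_real of_real_mult)
  thus "(LINT x|lborel. exp (- x\<^sup>2 / 2) *\<^sub>R iexp (s * x)) = of_real (sqrt (2 * pi) * exp (- s\<^sup>2 / 2))"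
    by (simp only: e[of x for x :: real] scaleR_scaleR)
qed

lemma gauss_iexp_prod:
  "gauss x *\<^sub>R iexp (s \<bullet> x) = (\<Prod>b\<in>Basis. exp (- (x \<bullet> b)\<^sup>2 / 2) *\<^sub>R iexp ((s \<bullet> b) * (x \<bullet> b)))"
proof -
  have "gauss x = (\<Prod>b\<in>Basis. exp (- (x \<bullet> b)\<^sup>2 / 2))"
    unfolding gauss_def exp_sum[OF finite_Basis, symmetric] power2_norm_eq_inner
    by (subst euclidean_inner) (simp add: sum_negf sum_divide_distrib power2_eq_square)
  moreover have "iexp (s \<bullet> x) = (\<Prod>b\<in>Basis. iexp ((s \<bullet> b) * (x \<bullet> b)))"
    unfolding exp_sum[OF finite_Basis, symmetric]
    by (subst euclidean_inner) (simp add: sum_distrib_left)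
  ultimately show ?thesis by (simp add: scaleR_conv_of_real prod.distrib)
qed

lemma Fourier_gauss:
  fixes s :: "'a::euclidean_space"
  shows "integrable lborel (\<lambda>x::'a. gauss x *\<^sub>R iexp (s \<bullet> x))"
    and "(LINT x|lborel. gauss (x::'a) *\<^sub>R iexp (s \<bullet> x)) = of_real (sqrt (2 * pi) ^ DIM('a) * gauss s)"
proof -
  show "integrable lborel (\<lambda>x::'a. gauss x *\<^sub>R iexp (s \<bullet> x))"
    unfolding gauss_iexp_prod
    by (rule lborel_integral_prod_Basis(1)[where u = "\<lambda>b y. exp (- y\<^sup>2 / 2) *\<^sub>R iexp ((s \<bullet> b) * y)"])
      (rule integral_gauss_real)
  have "(LINT x|lborel. gauss (x::'a) *\<^sub>R iexp (s \<bullet> x))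
      = (\<Prod>b\<in>Basis. LINT y|lborel. exp (- y\<^sup>2 / 2) *\<^sub>R iexp ((s \<bullet> b) * y))"
    unfolding gauss_iexp_prod
    by (rule lborel_integral_prod_Basis(2)[where u = "\<lambda>b y. exp (- y\<^sup>2 / 2) *\<^sub>R iexp ((s \<bullet> b) * y)"])
      (rule integral_gauss_real)
  also have "\<dots> = of_real (\<Prod>b\<in>Basis. sqrt (2 * pi) * exp (- (s \<bullet> b)\<^sup>2 / 2))"
    unfolding integral_gauss_real(2) by simp
  also have "(\<Prod>b\<in>Basis. sqrt (2 * pi) * exp (- (s \<bullet> b)\<^sup>2 / 2)) = sqrt (2 * pi) ^ DIM('a) * gauss s"
  proof -
    have "(norm s)\<^sup>2 = (\<Sum>b\<in>Basis. (s \<bullet> b)\<^sup>2)"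
      unfolding power2_norm_eq_inner by (subst euclidean_inner) (simp add: power2_eq_square)
    thus ?thesis
      unfolding gauss_def prod.distrib exp_sum[OF finite_Basis, symmetric]
      by (simp add: sum_negf sum_divide_distrib)
  qed
  finally show "(LINT x|lborel. gauss (x::'a) *\<^sub>R iexp (s \<bullet> x)) = of_real (sqrt (2 * pi) ^ DIM('a) * gauss s)" .
qed

lemma integrable_gauss: "integrable lborel (gauss :: 'a::euclidean_space \<Rightarrow> real)"
  using integrable_norm[OF Fourier_gauss(1)[of 0]] by (simp add: abs_of_pos[OF gauss_pos])

lemma integral_gauss: "(LINT x|lborel. gauss (x::'a::euclidean_space)) = sqrt (2 * pi) ^ DIM('a)"
proof -
  have "complex_of_real (LINT x|lborel. gauss (x::'a)) = of_real (sqrt (2 * pi) ^ DIM('a))"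
    using Fourier_gauss(2)[of "0::'a"]
    by (simp add: scaleR_conv_of_real gauss_def[of 0] del: of_real_power of_real_mult)
  thus ?thesis by (simp only: of_real_eq_iff)
qed

section \<open>Autocorrelations and Gaussian regularization\<close>

text \<open>For Borel functions the completed measure may be replaced by \<open>lborel\<close>, on
  whose product measure the Fubini arguments take place.\<close>

lemma fourier_L1_borel:
  assumes "f \<in> borel_measurable borel"
  shows "fourier_L1 f w = (LINT x|lborel. f x * iexp (- (2 * pi * (x \<bullet> w))))"
  unfolding fourier_L1_def using assms
  by (subst integral_completion) (auto intro!: Bochner_Integration.integral_cong simp: mult_ac)

lemma measurable_cnj [measurable]: "cnj \<in> borel_measurable borel"
  by (intro borel_measurable_continuous_onI continuous_intros)

lemma inner_L2_borel:
  assumes [measurable]: "f \<in> borel_measurable borel" "g \<in> borel_measurable borel"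
  shows "inner_L2 f (translate t g) = (LINT x|lborel. f x * cnj (g (x - t)))"
  unfolding inner_L2_def translate_def by (rule integral_completion) measurable

lemma reflect_integral:
  fixes f :: "'a::euclidean_space \<Rightarrow> 'b::{banach, second_countable_topology}"
  assumes "f \<in> borel_measurable borel"
  shows "(LINT t|lborel. f (x - t)) = (LINT t|lborel. f t)"
    and "integrable lborel f \<Longrightarrow> integrable lborel (\<lambda>t. f (x - t))"
  using lborel_affine_integral[OF assms, of "-1" x] by simp_all

text \<open>The phase has modulus 1, and after a reflection the inner integral of the modulus is
  \<open>cmod (f x)\<close> times the L1 norm of \<open>f\<close>; Tonelli does the rest. The case
  \<open>w = 0\<close> yields integrability of the autocorrelation itself.\<close>

lemma integrable_correlation_kernel:
  fixes f :: "'a::euclidean_space \<Rightarrow> complex"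
  assumes f [measurable]: "f \<in> borel_measurable borel" and int: "integrable lborel f"
  shows "integrable (lborel \<Otimes>\<^sub>M lborel) (\<lambda>(x, t). f x * cnj (f (x - t)) * iexp (- (2 * pi * (t \<bullet> w))))"
proof (rule lborel_pair.Fubini_integrable)
  have n: "norm (case (x, t) of (x, t) \<Rightarrow> f x * cnj (f (x - t)) * iexp (- (2 * pi * (t \<bullet> w))))
      = cmod (f x) * cmod (f (x - t))" for x t
    by (simp add: norm_mult norm_exp_i_times[of "- (2 * pi * (t \<bullet> w))", simplified])
  have eq: "(LINT t|lborel. cmod (f x) * cmod (f (x - t))) = cmod (f x) * (LINT t|lborel. cmod (f t))" for x
    using reflect_integral(1)[of "\<lambda>t. cmod (f t)" x] by simp
  show "integrable lborel (\<lambda>x. LINT t|lborel.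
      norm (case (x, t) of (x, t) \<Rightarrow> f x * cnj (f (x - t)) * iexp (- (2 * pi * (t \<bullet> w)))))"
    unfolding n eq using int by simp
  have "integrable lborel (\<lambda>t. f x * cnj (f (x - t)) * iexp (- (2 * pi * (t \<bullet> w))))" for x
  proof (rule Bochner_Integration.integrable_bound)
    show "integrable lborel (\<lambda>t. cmod (f x) * cmod (f (x - t)))"
      using reflect_integral(2)[of "\<lambda>t. cmod (f t)" x] int by simp
    show "AE t in lborel. norm (f x * cnj (f (x - t)) * iexp (- (2 * pi * (t \<bullet> w))))
        \<le> norm (cmod (f x) * cmod (f (x - t)))"
      using n by simp
  qed measurable
  thus "AE x in lborel. integrable lborel
      (\<lambda>t. case (x, t) of (x, t) \<Rightarrow> f x * cnj (f (x - t)) * iexp (- (2 * pi * (t \<bullet> w))))"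
    by simp
qed measurable

text \<open>The autocorrelation is the convolution of \<open>f\<close> with its conjugate
  reflection. After Fubini, the substitution \<open>t = x - y\<close> splits the phase, and the
  double integral factors into the transform and its conjugate.\<close>

lemma Fourier_correlation:
  fixes f :: "'a::euclidean_space \<Rightarrow> complex"
  assumes f [measurable]: "f \<in> borel_measurable borel" and int: "integrable lborel f"
  shows "integrable lborel (\<lambda>t. inner_L2 f (translate t f))"
    and "(LINT t|lborel. inner_L2 f (translate t f) * iexp (- (2 * pi * (t \<bullet> w))))
      = of_real ((cmod (fourier_L1 f w))\<^sup>2)"
proof -
  note K = integrable_correlation_kernel[OF assms]
  show "integrable lborel (\<lambda>t. inner_L2 f (translate t f))"
    unfolding inner_L2_borel[OF f f] using lborel_pair.integrable_snd[OF K[of 0]] by simp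
  have "(LINT t|lborel. inner_L2 f (translate t f) * iexp (- (2 * pi * (t \<bullet> w))))
      = (LINT t|lborel. LINT x|lborel. f x * cnj (f (x - t)) * iexp (- (2 * pi * (t \<bullet> w))))"
    unfolding inner_L2_borel[OF f f] by simp
  also have "\<dots> = (LINT x|lborel. LINT t|lborel. f x * cnj (f (x - t)) * iexp (- (2 * pi * (t \<bullet> w))))"
    by (rule lborel_pair.Fubini_integral[OF K])
  also have "\<dots> = (LINT x|lborel. f x * iexp (- (2 * pi * (x \<bullet> w))) * cnj (fourier_L1 f w))"
  proof (rule Bochner_Integration.integral_cong[OF refl])
    fix x
    have "(LINT t|lborel. f x * cnj (f (x - t)) * iexp (- (2 * pi * (t \<bullet> w))))
        = (LINT y|lborel. f x * cnj (f (x - (x - y))) * iexp (- (2 * pi * ((x - y) \<bullet> w))))"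
      by (rule reflect_integral(1)[symmetric]) measurable
    also have "\<dots> = (LINT y|lborel. f x * iexp (- (2 * pi * (x \<bullet> w))) * cnj (f y * iexp (- (2 * pi * (y \<bullet> w)))))"
      by (intro Bochner_Integration.integral_cong refl)
        (simp add: exp_cnj inner_diff_left algebra_simps flip: exp_add)
    also have "\<dots> = f x * iexp (- (2 * pi * (x \<bullet> w))) * cnj (fourier_L1 f w)"
      unfolding fourier_L1_borel[OF f] Bochner_Integration.integral_cnj[symmetric] by (rule integral_mult_right_zero)
    finally show "(LINT t|lborel. f x * cnj (f (x - t)) * iexp (- (2 * pi * (t \<bullet> w))))
      = f x * iexp (- (2 * pi * (x \<bullet> w))) * cnj (fourier_L1 f w)" .
  qed
  also have "\<dots> = fourier_L1 f w * cnj (fourier_L1 f w)"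
    unfolding fourier_L1_borel[OF f] by (rule integral_mult_left_zero)
  finally show "(LINT t|lborel. inner_L2 f (translate t f) * iexp (- (2 * pi * (t \<bullet> w))))
      = of_real ((cmod (fourier_L1 f w))\<^sup>2)"
    by (simp only: complex_norm_square)
qed

text \<open>Substitute \<open>v = (2 * pi * \<epsilon>) *\<^sub>R w\<close> in the Gaussian
  transform at \<open>s /\<^sub>R \<epsilon>\<close>. As a function of \<open>s\<close>, the result
  is the Gaussian of width \<open>\<epsilon>\<close> and total mass 1, hence an approximate
  identity.\<close>

lemma integral_gauss_dilated:
  fixes s :: "'a::euclidean_space"
  assumes "\<epsilon> > 0"
  shows "integrable lborel (\<lambda>w::'a. gauss ((2 * pi * \<epsilon>) *\<^sub>R w))"
    and "(LINT w|lborel. gauss ((2 * pi * \<epsilon>) *\<^sub>R w) *\<^sub>R iexp (2 * pi * (s \<bullet> w)))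
      = of_real ((sqrt (2 * pi) / (2 * pi * \<epsilon>)) ^ DIM('a) * gauss (s /\<^sub>R \<epsilon>))"
proof -
  let ?c = "2 * pi * \<epsilon>"
  have c: "?c \<noteq> 0" "?c > 0" using assms by auto
  show "integrable lborel (\<lambda>w::'a. gauss (?c *\<^sub>R w))"
    using lborel_affine_integral(2)[OF gauss_measurable c(1) integrable_gauss, of 0] by simp
  have "of_real (sqrt (2 * pi) ^ DIM('a) * gauss (s /\<^sub>R \<epsilon>))
      = (LINT v|lborel. gauss v *\<^sub>R iexp ((s /\<^sub>R \<epsilon>) \<bullet> v))"
    by (simp only: Fourier_gauss(2))
  also have "\<dots> = \<bar>?c\<bar> ^ DIM('a) *\<^sub>R
      (LINT w|lborel. gauss (0 + ?c *\<^sub>R w) *\<^sub>R iexp ((s /\<^sub>R \<epsilon>) \<bullet> (0 + ?c *\<^sub>R w)))"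
    by (rule lborel_affine_integral(1)[OF _ c(1)]) measurable
  also have "(\<lambda>w. gauss (0 + ?c *\<^sub>R w) *\<^sub>R iexp ((s /\<^sub>R \<epsilon>) \<bullet> (0 + ?c *\<^sub>R w)))
      = (\<lambda>w. gauss (?c *\<^sub>R w) *\<^sub>R iexp (2 * pi * (s \<bullet> w)))"
    using assms by (intro ext) (simp add: field_simps)
  finally have "complex_of_real (sqrt (2 * pi) ^ DIM('a) * gauss (s /\<^sub>R \<epsilon>))
      = ?c ^ DIM('a) *\<^sub>R (LINT w|lborel. gauss (?c *\<^sub>R w) *\<^sub>R iexp (2 * pi * (s \<bullet> w)))"
    using c(2) by simp
  thus "(LINT w|lborel. gauss (?c *\<^sub>R w) *\<^sub>R iexp (2 * pi * (s \<bullet> w)))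
      = of_real ((sqrt (2 * pi) / ?c) ^ DIM('a) * gauss (s /\<^sub>R \<epsilon>))"
    using c by (simp add: scaleR_conv_of_real power_divide field_simps)
qed

text \<open>The Gaussian weight makes the double integral absolutely convergent, so the integrals
  may be exchanged. The inner one is then a Gaussian around \<open>a\<close> of width
  \<open>\<epsilon>\<close>, and \<open>t = a - \<epsilon> *\<^sub>R u\<close> rescales it to unit
  width.\<close>

lemma Gauss_regularized_inversion:
  fixes A :: "'a::euclidean_space \<Rightarrow> complex"
  assumes A [measurable]: "A \<in> borel_measurable borel" and int: "integrable lborel A" and "\<epsilon> > 0"
  shows "(LINT w|lborel. (LINT t|lborel. A t * iexp (- (2 * pi * (t \<bullet> w)))) * iexp (2 * pi * (a \<bullet> w))
           * of_real (gauss ((2 * pi * \<epsilon>) *\<^sub>R w)))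
      = of_real (1 / sqrt (2 * pi) ^ DIM('a)) * (LINT u|lborel. A (a - \<epsilon> *\<^sub>R u) * of_real (gauss u))"
proof -
  let ?c = "2 * pi * \<epsilon>"
  let ?K = "\<lambda>w t. A t * iexp (- (2 * pi * (t \<bullet> w))) * iexp (2 * pi * (a \<bullet> w)) * of_real (gauss (?c *\<^sub>R w))"
  have iexp1: "cmod (iexp r) = 1" for r :: real by simp
  have n: "cmod (?K w t) = gauss (?c *\<^sub>R w) * cmod (A t)" for w t
    unfolding norm_mult iexp1 by (simp add: abs_of_pos[OF gauss_pos])
  have K: "integrable (lborel \<Otimes>\<^sub>M lborel) (\<lambda>(t, w). ?K w t)"
  proof (rule lborel_pair.Fubini_integrable)
    show "integrable lborel (\<lambda>t. LINT w|lborel. norm (case (t, w) of (t, w) \<Rightarrow> ?K w t))"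
      unfolding prod.case n using int by simp
    show "AE t in lborel. integrable lborel (\<lambda>w. case (t, w) of (t, w) \<Rightarrow> ?K w t)"
    proof (rule AE_I2, unfold prod.case)
      fix t
      show "integrable lborel (\<lambda>w. ?K w t)"
      proof (rule Bochner_Integration.integrable_bound)
        show "integrable lborel (\<lambda>w. gauss (?c *\<^sub>R w) * cmod (A t))"
          by (intro integrable_mult_left integral_gauss_dilated assms)
        show "AE w in lborel. norm (?K w t) \<le> norm (gauss (?c *\<^sub>R w) * cmod (A t))"
          unfolding n by simp
      qed measurable
    qed
  qed measurable
  have "(LINT w|lborel. (LINT t|lborel. A t * iexp (- (2 * pi * (t \<bullet> w)))) * iexp (2 * pi * (a \<bullet> w))
        * of_real (gauss (?c *\<^sub>R w))) = (LINT w|lborel. LINT t|lborel. ?K w t)"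
    by (simp only: integral_mult_left_zero)
  also have "\<dots> = (LINT t|lborel. LINT w|lborel. ?K w t)"
    by (rule lborel_pair.Fubini_integral[OF K])
  also have "\<dots> = (LINT t|lborel. A t * of_real ((sqrt (2 * pi) / ?c) ^ DIM('a) * gauss ((a - t) /\<^sub>R \<epsilon>)))"
  proof (rule Bochner_Integration.integral_cong[OF refl])
    fix t
    have "(LINT w|lborel. ?K w t)
        = (LINT w|lborel. A t * (gauss (?c *\<^sub>R w) *\<^sub>R iexp (2 * pi * ((a - t) \<bullet> w))))"
      by (intro Bochner_Integration.integral_cong refl)
        (simp add: scaleR_conv_of_real inner_diff_left algebra_simps flip: exp_add)
    thus "(LINT w|lborel. ?K w t) = A t * of_real ((sqrt (2 * pi) / ?c) ^ DIM('a) * gauss ((a - t) /\<^sub>R \<epsilon>))"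
      by (simp only: integral_mult_right_zero integral_gauss_dilated(2)[OF \<open>\<epsilon> > 0\<close>])
  qed
  also have "\<dots> = \<bar>- \<epsilon>\<bar> ^ DIM('a) *\<^sub>R (LINT u|lborel. A (a + (- \<epsilon>) *\<^sub>R u)
      * of_real ((sqrt (2 * pi) / ?c) ^ DIM('a) * gauss ((a - (a + (- \<epsilon>) *\<^sub>R u)) /\<^sub>R \<epsilon>)))"
    using \<open>\<epsilon> > 0\<close> by (intro lborel_affine_integral(1)) auto
  also have "\<dots> = (LINT u|lborel. of_real (1 / sqrt (2 * pi) ^ DIM('a)) * (A (a - \<epsilon> *\<^sub>R u) * of_real (gauss u)))"
  proof -
    \<comment> \<open>The Jacobian \<open>\<epsilon> ^ DIM('a)\<close> of the rescaling cancels the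
      width in the Gaussian constant.\<close>
    have "sqrt (2 * pi) * sqrt (2 * pi) = 2 * pi" by simp
    hence "\<epsilon> * (sqrt (2 * pi) / ?c) = 1 / sqrt (2 * pi)" using \<open>\<epsilon> > 0\<close> by (simp add: field_simps)
    hence "\<epsilon> ^ DIM('a) * (sqrt (2 * pi) / ?c) ^ DIM('a) = 1 / sqrt (2 * pi) ^ DIM('a)"
      by (simp only: power_mult_distrib[symmetric] power_one_over)
    hence k: "complex_of_real (\<epsilon> ^ DIM('a)) * of_real ((sqrt (2 * pi) / ?c) ^ DIM('a))
        = of_real (1 / sqrt (2 * pi) ^ DIM('a))"
      by (simp only: of_real_mult[symmetric])
    show ?thesis
      unfolding integral_scaleR_right[symmetric]
    proof (rule Bochner_Integration.integral_cong[OF refl])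
      fix u
      have "(a - (a + (- \<epsilon>) *\<^sub>R u)) /\<^sub>R \<epsilon> = u" "a + (- \<epsilon>) *\<^sub>R u = a - \<epsilon> *\<^sub>R u" "\<bar>- \<epsilon>\<bar> = \<epsilon>"
        using \<open>\<epsilon> > 0\<close> by auto
      thus "\<bar>- \<epsilon>\<bar> ^ DIM('a) *\<^sub>R (A (a + (- \<epsilon>) *\<^sub>R u)
          * of_real ((sqrt (2 * pi) / ?c) ^ DIM('a) * gauss ((a - (a + (- \<epsilon>) *\<^sub>R u)) /\<^sub>R \<epsilon>)))
          = of_real (1 / sqrt (2 * pi) ^ DIM('a)) * (A (a - \<epsilon> *\<^sub>R u) * of_real (gauss u))"
        unfolding k[symmetric] by (simp only: scaleR_conv_of_real of_real_mult mult_ac)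
    qed
  qed
  finally show ?thesis by (simp only: integral_mult_right_zero)
qed

text \<open>With \<open>\<epsilon> = 1 / (real n + 1)\<close> the right side of the regularized
  formula averages \<open>A\<close> ever closer to \<open>a\<close>. Continuity gives the limit of
  the integrand, and boundedness of \<open>A\<close> gives the bound
  \<open>B * gauss u\<close>.\<close>

lemma Gauss_inversion_limit:
  fixes A :: "'a::euclidean_space \<Rightarrow> complex"
  assumes cont: "continuous_on UNIV A" and int: "integrable lborel A" and bd: "\<And>t. cmod (A t) \<le> B"
  shows "(\<lambda>n. LINT w|lborel. (LINT t|lborel. A t * iexp (- (2 * pi * (t \<bullet> w)))) * iexp (2 * pi * (a \<bullet> w))
           * of_real (gauss ((2 * pi * (1 / (real n + 1))) *\<^sub>R w))) \<longlonglongrightarrow> A a"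
proof -
  have A [measurable]: "A \<in> borel_measurable borel" by (rule borel_measurable_continuous_onI[OF cont])
  have "(\<lambda>n. LINT u|lborel. A (a - (1 / (real n + 1)) *\<^sub>R u) * of_real (gauss u))
      \<longlonglongrightarrow> (LINT u::'a|lborel. A a * of_real (gauss u))"
  proof (rule integral_dominated_convergence[where w = "\<lambda>u. B * gauss u"])
    show "integrable lborel (\<lambda>u::'a. B * gauss u)" by (intro integrable_mult_right integrable_gauss)
    show "AE u in lborel. (\<lambda>n. A (a - (1 / (real n + 1)) *\<^sub>R u) * of_real (gauss u)) \<longlonglongrightarrow> A a * of_real (gauss u)"
    proof (rule AE_I2)
      fix u :: 'a
      have "(\<lambda>n. 1 / (real n + 1)) \<longlonglongrightarrow> 0" by real_asymp
      hence "(\<lambda>n. a - (1 / (real n + 1)) *\<^sub>R u) \<longlonglongrightarrow> a - 0 *\<^sub>R u"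
        by (intro tendsto_diff tendsto_scaleR tendsto_const)
      moreover have "isCont A (a - 0 *\<^sub>R u)" using cont by (simp add: continuous_on_eq_continuous_at)
      ultimately have "(\<lambda>n. A (a - (1 / (real n + 1)) *\<^sub>R u)) \<longlonglongrightarrow> A (a - 0 *\<^sub>R u)"
        by (rule isCont_tendsto_compose[rotated])
      thus "(\<lambda>n. A (a - (1 / (real n + 1)) *\<^sub>R u) * of_real (gauss u)) \<longlonglongrightarrow> A a * of_real (gauss u)"
        by (intro tendsto_mult tendsto_const) simp
    qed
    show "AE u in lborel. norm (A (a - (1 / (real n + 1)) *\<^sub>R u) * of_real (gauss u)) \<le> B * gauss u" for n
      by (simp add: norm_mult abs_of_pos[OF gauss_pos] mult_right_mono bd less_imp_le[OF gauss_pos])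
  qed measurable
  \<comment> \<open>The prefactor is the reciprocal of the total mass of \<open>gauss\<close>, so
    the limit is exactly \<open>A a\<close>. The long rule instance below only says that
    \<open>1 / (real n + 1)\<close> is positive.\<close>
  from tendsto_mult[OF tendsto_const[of "of_real (1 / sqrt (2 * pi) ^ DIM('a))"] this]
  show ?thesis
    unfolding Gauss_regularized_inversion[OF A int zero_less_divide_1_iff[THEN iffD2, OF add_nonneg_pos[OF of_nat_0_le_iff zero_less_one]]]
    by (simp add: integral_gauss flip: of_real_power)
qed

section \<open>Plancherel's theorem\<close>

lemma gauss_dilations_tendsto: "(\<lambda>n. gauss ((2 * pi * (1 / (real n + 1))) *\<^sub>R w)) \<longlonglongrightarrow> 1"
proof -
  have "(\<lambda>n. 2 * pi * (1 / (real n + 1))) \<longlonglongrightarrow> 0" by real_asymp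
  hence "(\<lambda>n. exp (- (norm ((2 * pi * (1 / (real n + 1))) *\<^sub>R w))\<^sup>2 / 2)) \<longlonglongrightarrow> exp (- (norm (0 *\<^sub>R w))\<^sup>2 / 2)"
    by (intro tendsto_exp tendsto_divide tendsto_minus tendsto_power tendsto_norm tendsto_scaleR tendsto_const) auto
  thus ?thesis by (simp add: gauss_def)
qed

text \<open>At \<open>a = 0\<close> the identity is the equality of norms; general \<open>a\<close>
  gives the Fourier integrals of the squared modulus of the transform, which are the Gram entries
  wanted in the end.\<close>

lemma fourier_L1_Plancherel_borel:
  fixes f :: "'a::euclidean_space \<Rightarrow> complex"
  assumes f [measurable]: "f \<in> borel_measurable borel" and int: "integrable lborel f" and L2: "f \<in> L2"
  shows "fourier_L1 f \<in> L2"
    and "inner_L2 (\<lambda>w. iexp (2 * pi * (a \<bullet> w)) * fourier_L1 f w) (fourier_L1 f) = inner_L2 f (translate a f)"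
proof -
  let ?A = "\<lambda>t. inner_L2 f (translate t f)"
  let ?h = "fourier_L1 f"
  let ?\<gamma> = "\<lambda>n w. gauss ((2 * pi * (1 / (real n + 1))) *\<^sub>R w) :: real"
  have cont: "continuous_on UNIV ?A"
    by (rule continuous_on_correlation) (use L2 int in \<open>auto simp: integrable_completion\<close>)
  have bd: "cmod (?A t) \<le> norm_L2 f * norm_L2 f" for t
    using Cauchy_Schwarz_L2[OF L2 L2_translate[OF L2], of t] by (simp add: norm_L2_translate[OF L2])
  have lim: "(\<lambda>n. LINT w|lborel. of_real ((cmod (?h w))\<^sup>2) * iexp (2 * pi * (b \<bullet> w)) * of_real (?\<gamma> n w))
      \<longlonglongrightarrow> ?A b" for b
    using Gauss_inversion_limit[OF cont Fourier_correlation(1)[OF f int] bd, of b]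
    unfolding Fourier_correlation(2)[OF f int] .
  have h [measurable]: "?h \<in> borel_measurable borel"
    unfolding fourier_L1_borel[OF f, abs_def] by measurable
  have hm: "?h \<in> borel_measurable lebesgue"
    by (intro measurable_completion) simp
  have \<gamma>int: "integrable lborel (?\<gamma> n :: 'a \<Rightarrow> real)" for n
    by (rule integral_gauss_dilated(1)) simp
  \<comment> \<open>The L1 norm bounds the transform uniformly, so the Gaussian weight makes
    \<open>V n\<close> square-integrable before \<open>?h\<close> is known to be.\<close>
  define F where "F = (LINT x|lborel. cmod (f x))"
  have hF: "cmod (?h w) \<le> F" for w
  proof -
    have "cmod (iexp r) = 1" for r :: real by simp
    thus ?thesis
      unfolding fourier_L1_borel[OF f] F_def
      using integral_norm_bound[of lborel "\<lambda>x. f x * iexp (- (2 * pi * (x \<bullet> w)))"] by (simp only: norm_mult mult_1_right)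
  qed
  \<comment> \<open>The square root of the weight is used so that the squared norm of
    \<open>V n\<close> is the regularized inversion integral at 0.\<close>
  define V where "V n w = ?h w * of_real (sqrt (?\<gamma> n w))" for n w
  have Vsq: "(cmod (V n w))\<^sup>2 = (cmod (?h w))\<^sup>2 * ?\<gamma> n w" for n w
    by (simp add: V_def norm_mult power_mult_distrib gauss_pos less_imp_le)
  have Vm [measurable]: "V n \<in> borel_measurable borel" for n
    unfolding V_def by measurable
  have VL2: "V n \<in> L2" for n
  proof (rule L2_bound)
    show "V n \<in> borel_measurable lebesgue" by (intro measurable_completion) simp
    have "integrable lborel (\<lambda>w::'a. F\<^sup>2 * ?\<gamma> n w)" by (intro integrable_mult_right \<gamma>int)
    thus "integrable lebesgue (\<lambda>w::'a. F\<^sup>2 * ?\<gamma> n w)" by (subst integrable_completion) auto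
    show "(cmod (V n w))\<^sup>2 \<le> F\<^sup>2 * ?\<gamma> n w" for w
      unfolding Vsq by (intro mult_right_mono power_mono hF) (auto simp: gauss_pos less_imp_le)
  qed
  have "(\<lambda>n. complex_of_real ((norm_L2 (V n))\<^sup>2)) \<longlonglongrightarrow> ?A 0"
  proof -
    have "complex_of_real ((norm_L2 (V n))\<^sup>2) =
        (LINT w|lborel. of_real ((cmod (?h w))\<^sup>2) * iexp (2 * pi * (0 \<bullet> w)) * of_real (?\<gamma> n w))" for n
    proof -
      have "(norm_L2 (V n))\<^sup>2 = (LINT w|lborel. (cmod (V n w))\<^sup>2)"
        unfolding norm_L2_power2 by (rule integral_completion) measurable
      thus ?thesis unfolding Vsq by (simp flip: integral_complex_of_real)
    qed
    thus ?thesis using lim[of 0] by simp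
  qed
  hence "(\<lambda>n. Re (complex_of_real ((norm_L2 (V n))\<^sup>2))) \<longlonglongrightarrow> Re (?A 0)"
    by (rule tendsto_Re)
  hence "\<forall>\<^sub>F n in sequentially. (norm_L2 (V n))\<^sup>2 < Re (?A 0) + 1"
    by (intro order_tendstoD(2)) auto
  \<comment> \<open>The squared norms converge, hence stay below their limit plus 1 from some index
    on; Fatou asks for no sharper bound.\<close>
  then obtain K where K: "\<And>n. n \<ge> K \<Longrightarrow> (norm_L2 (V n))\<^sup>2 < Re (?A 0) + 1"
    by (auto simp: eventually_sequentially)
  have Vlim: "AE w in lebesgue. (\<lambda>n. V n w) \<longlonglongrightarrow> ?h w"
  proof (rule AE_I2)
    fix w :: 'a
    have "(\<lambda>n. ?h w * of_real (sqrt (?\<gamma> n w))) \<longlonglongrightarrow> ?h w * of_real (sqrt 1)"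
      by (intro tendsto_mult tendsto_const tendsto_of_real tendsto_real_sqrt gauss_dilations_tendsto)
    thus "(\<lambda>n. V n w) \<longlonglongrightarrow> ?h w" by (simp add: V_def)
  qed
  have Vbound: "norm_L2 (V n) \<le> sqrt (Re (?A 0) + 1)" if "n \<ge> K" for n
    using K[OF that] by (intro real_le_rsqrt) simp
  have c0: "0 \<le> sqrt (Re (?A 0) + 1)"
    by (rule order_trans[OF norm_L2_nonneg Vbound[OF order_refl]])
  show hL2: "?h \<in> L2"
    by (rule L2_Fatou(1)[OF VL2 Vbound hm Vlim c0])
  have "(\<lambda>n. LINT w|lborel. of_real ((cmod (?h w))\<^sup>2) * iexp (2 * pi * (a \<bullet> w)) * of_real (?\<gamma> n w))
      \<longlonglongrightarrow> (LINT w|lborel. of_real ((cmod (?h w))\<^sup>2) * iexp (2 * pi * (a \<bullet> w)))"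
  \<comment> \<open>The bound, the squared modulus of \<open>?h\<close>, is integrable by
    \<open>hL2\<close>; this is why membership in \<open>L2\<close> comes first.\<close>
  proof (rule integral_dominated_convergence[where w = "\<lambda>w. (cmod (?h w))\<^sup>2"])
    show "integrable lborel (\<lambda>w. (cmod (?h w))\<^sup>2)"
      using L2_integrable_square[OF hL2] by (subst (asm) integrable_completion) auto
    show "AE w in lborel. (\<lambda>n. of_real ((cmod (?h w))\<^sup>2) * iexp (2 * pi * (a \<bullet> w)) * of_real (?\<gamma> n w))
        \<longlonglongrightarrow> of_real ((cmod (?h w))\<^sup>2) * iexp (2 * pi * (a \<bullet> w))"
    proof (rule AE_I2)
      fix w
      show "(\<lambda>n. of_real ((cmod (?h w))\<^sup>2) * iexp (2 * pi * (a \<bullet> w)) * of_real (?\<gamma> n w))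
        \<longlonglongrightarrow> of_real ((cmod (?h w))\<^sup>2) * iexp (2 * pi * (a \<bullet> w))"
        using tendsto_mult[OF tendsto_const[of "of_real ((cmod (?h w))\<^sup>2) * iexp (2 * pi * (a \<bullet> w))"]
            tendsto_of_real[OF gauss_dilations_tendsto[of w]]] by simp
    qed
    show "AE w in lborel. norm (of_real ((cmod (?h w))\<^sup>2) * iexp (2 * pi * (a \<bullet> w)) * of_real (?\<gamma> n w))
        \<le> (cmod (?h w))\<^sup>2" for n
    proof (rule AE_I2)
      fix w
      have "cmod (iexp r) = 1" for r :: real by simp
      hence "norm (of_real ((cmod (?h w))\<^sup>2) * iexp (2 * pi * (a \<bullet> w)) * of_real (?\<gamma> n w))
          = (cmod (?h w))\<^sup>2 * ?\<gamma> n w"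
        by (simp only: norm_mult norm_of_real mult_1_right abs_of_pos[OF gauss_pos] abs_power2)
      thus "norm (of_real ((cmod (?h w))\<^sup>2) * iexp (2 * pi * (a \<bullet> w)) * of_real (?\<gamma> n w)) \<le> (cmod (?h w))\<^sup>2"
        by (simp only: mult_left_le[OF gauss_le_1 zero_le_power2])
    qed
  qed measurable
  from LIMSEQ_unique[OF this lim[of a]]
  have "(LINT w|lborel. of_real ((cmod (?h w))\<^sup>2) * iexp (2 * pi * (a \<bullet> w))) = ?A a" .
  moreover have "inner_L2 (\<lambda>w. iexp (2 * pi * (a \<bullet> w)) * ?h w) ?h
      = (LINT w|lborel. of_real ((cmod (?h w))\<^sup>2) * iexp (2 * pi * (a \<bullet> w)))"
  proof -
    have "inner_L2 (\<lambda>w. iexp (2 * pi * (a \<bullet> w)) * ?h w) ?h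
        = (LINT w|lborel. iexp (2 * pi * (a \<bullet> w)) * ?h w * cnj (?h w))"
      unfolding inner_L2_def by (rule integral_completion) measurable
    thus ?thesis by (simp only: complex_norm_square mult_ac)
  qed
  ultimately show "inner_L2 (\<lambda>w. iexp (2 * pi * (a \<bullet> w)) * ?h w) ?h = ?A a" by simp
qed

section \<open>From Borel to Lebesgue measurable functions\<close>

lemma borel_representative:
  fixes f :: "'a::euclidean_space \<Rightarrow> complex"
  assumes "f \<in> borel_measurable lebesgue"
  obtains g where "g \<in> borel_measurable borel" "AE x in lebesgue. f x = g x"
proof -
  have m: "(\<lambda>x. Re (f x)) \<in> borel_measurable lebesgue" "(\<lambda>x. Im (f x)) \<in> borel_measurable lebesgue"
    using assms by auto
  obtain r where r: "r \<in> borel_measurable lborel" "AE x in lborel. Re (f x) = r x"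
    using completion_ex_borel_measurable_real[OF m(1)] by blast
  obtain i where i: "i \<in> borel_measurable lborel" "AE x in lborel. Im (f x) = i x"
    using completion_ex_borel_measurable_real[OF m(2)] by blast
  have [measurable]: "r \<in> borel_measurable borel" "i \<in> borel_measurable borel" using r i by auto
  have "AE x in lborel. f x = of_real (r x) + \<i> * of_real (i x)"
    using r(2) i(2) by eventually_elim (simp add: complex_eq_iff)
  hence "AE x in lebesgue. f x = of_real (r x) + \<i> * of_real (i x)" by (rule AE_completion)
  thus ?thesis by (rule that[rotated]) measurable
qed

text \<open>A Borel representative \<open>g\<close> of \<open>f\<close> has the same transform at
  every point and the same autocorrelation, so the Borel case carries over.\<close>

lemma fourier_L1_Plancherel:
  fixes f :: "'a::euclidean_space \<Rightarrow> complex"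
  assumes int: "integrable lebesgue f" and f: "f \<in> L2"
  shows "fourier_L1 f \<in> L2"
    and "inner_L2 (\<lambda>w. iexp (2 * pi * (a \<bullet> w)) * fourier_L1 f w) (fourier_L1 f) = inner_L2 f (translate a f)"
proof -
  have fm [measurable]: "f \<in> borel_measurable lebesgue" using f by (rule L2_measurable)
  obtain g where g [measurable]: "g \<in> borel_measurable borel" and fg: "AE x in lebesgue. f x = g x"
    by (rule borel_representative[OF fm])
  have gm [measurable]: "g \<in> borel_measurable lebesgue" by (intro measurable_completion) simp
  have intg: "integrable lborel g"
    using int integrable_cong_AE[OF fm gm fg] by (simp add: integrable_completion)
  have "AE x in lebesgue. (cmod (f x))\<^sup>2 = (cmod (g x))\<^sup>2" using fg by eventually_elim simp
  hence "integrable lebesgue (\<lambda>x. (cmod (g x))\<^sup>2)"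
    using f integrable_cong_AE[of "\<lambda>x. (cmod (f x))\<^sup>2" lebesgue "\<lambda>x. (cmod (g x))\<^sup>2"] by (simp add: L2_def)
  hence gL2: "g \<in> L2" by (simp add: L2_def)
  have hat: "fourier_L1 f = fourier_L1 g"
  proof
    fix w
    have [measurable]: "(\<lambda>x. exp (- 2 * of_real pi * \<i> * of_real (x \<bullet> w))) \<in> borel_measurable (lebesgue :: 'a measure)"
      by (intro continuous_imp_measurable_lebesgue continuous_intros)
    show "fourier_L1 f w = fourier_L1 g w"
      unfolding fourier_L1_def
    proof (rule integral_cong_AE)
      show "AE x in lebesgue. f x * exp (- 2 * of_real pi * \<i> * of_real (x \<bullet> w))
          = g x * exp (- 2 * of_real pi * \<i> * of_real (x \<bullet> w))"
        using fg by eventually_elim simp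
    qed measurable
  qed
  have "norm_L2 (\<lambda>x. g x - f x) = sqrt (LINT x::'a|lebesgue. 0)"
    unfolding norm_L2_def using fg by (intro arg_cong[of _ _ sqrt] integral_cong_AE) auto
  \<comment> \<open>A constant sequence converging in L2 encodes equality almost everywhere;
    continuity of the inner product then identifies the autocorrelations.\<close>
  hence c: "converges_L2 (\<lambda>_::nat. g) f" using f gL2 by (simp add: converges_L2_def)
  have "inner_L2 g (translate a g) = inner_L2 f (translate a f)"
    using inner_L2_tendsto[OF c converges_L2_translate[OF c]] by (simp add: LIMSEQ_const_iff)
  thus "fourier_L1 f \<in> L2"
    "inner_L2 (\<lambda>w. iexp (2 * pi * (a \<bullet> w)) * fourier_L1 f w) (fourier_L1 f) = inner_L2 f (translate a f)"
    unfolding hat using fourier_L1_Plancherel_borel(1)[OF g intg gL2] fourier_L1_Plancherel_borel(2)[OF g intg gL2, of a] by simp_all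
qed

section \<open>The isometry and its extension to L2\<close>

lemma norm_fourier_L1:
  assumes "integrable lebesgue f" "f \<in> L2"
  shows "norm_L2 (fourier_L1 f) = norm_L2 f"
proof -
  have "translate 0 f = f" by (simp add: translate_def)
  hence "complex_of_real ((norm_L2 (fourier_L1 f))\<^sup>2) = of_real ((norm_L2 f)\<^sup>2)"
    using fourier_L1_Plancherel(2)[OF assms, of 0] by (simp add: inner_L2_self)
  thus ?thesis by (simp only: of_real_eq_iff power2_eq_iff_nonneg[OF norm_L2_nonneg norm_L2_nonneg])
qed

lemma integrable_fourier_kernel:
  assumes "integrable lebesgue f"
  shows "integrable lebesgue (\<lambda>x. f x * exp (- 2 * of_real pi * \<i> * of_real (x \<bullet> w)))"
proof (rule Bochner_Integration.integrable_bound[OF assms])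
  have [measurable]: "(\<lambda>x. exp (- 2 * of_real pi * \<i> * of_real (x \<bullet> w))) \<in> borel_measurable lebesgue"
    by (intro continuous_imp_measurable_lebesgue continuous_intros)
  show "(\<lambda>x. f x * exp (- 2 * of_real pi * \<i> * of_real (x \<bullet> w))) \<in> borel_measurable lebesgue"
    using assms by measurable
qed (simp add: norm_mult)

lemma fourier_L1_diff:
  assumes "integrable lebesgue f" "integrable lebesgue g"
  shows "fourier_L1 (\<lambda>x. f x - g x) w = fourier_L1 f w - fourier_L1 g w"
  unfolding fourier_L1_def left_diff_distrib
  by (intro Bochner_Integration.integral_diff integrable_fourier_kernel assms)

lemma is_fourier_L2_correlation:
  assumes "is_fourier_L2 \<phi> g"
  shows "inner_L2 (\<lambda>w. iexp (2 * pi * (a \<bullet> w)) * g w) g = inner_L2 \<phi> (translate a \<phi>)"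
proof -
  obtain F where F: "\<And>n. integrable lebesgue (F n)" "converges_L2 F \<phi>" "converges_L2 (\<lambda>n. fourier_L1 (F n)) g"
    using assms by (auto simp: is_fourier_L2_def)
  have FL2: "F n \<in> L2" for n using F(2) by (simp add: converges_L2_def)
  have "(\<lambda>w. iexp (2 * pi * (a \<bullet> w))) \<in> borel_measurable lebesgue"
    by (intro continuous_imp_measurable_lebesgue continuous_intros)
  from converges_L2_mult_unimodular[OF F(3) this]
  have "converges_L2 (\<lambda>n w. iexp (2 * pi * (a \<bullet> w)) * fourier_L1 (F n) w) (\<lambda>w. iexp (2 * pi * (a \<bullet> w)) * g w)"
    by simp
  from inner_L2_tendsto[OF this F(3)]
  have "(\<lambda>n. inner_L2 (F n) (translate a (F n))) \<longlonglongrightarrow> inner_L2 (\<lambda>w. iexp (2 * pi * (a \<bullet> w)) * g w) g"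
    by (simp only: fourier_L1_Plancherel(2)[OF F(1) FL2])
  thus ?thesis
    using inner_L2_tendsto[OF F(2) converges_L2_translate[OF F(2)]] by (rule LIMSEQ_unique)
qed

text \<open>The truncations of \<open>\<phi>\<close> to balls are integrable and converge to it in
  L2. By the isometry their transforms form a Cauchy sequence, and completeness provides the
  limit.\<close>

lemma is_fourier_L2_exists:
  fixes \<phi> :: "'a::euclidean_space \<Rightarrow> complex"
  assumes \<phi>: "\<phi> \<in> L2"
  shows "\<exists>g. is_fourier_L2 \<phi> g"
proof -
  have \<phi>m [measurable]: "\<phi> \<in> borel_measurable lebesgue" using \<phi> by (rule L2_measurable)
  define F where "F n x = indicator (cball 0 (real n)) x * \<phi> x" for n x
  have Fm [measurable]: "F n \<in> borel_measurable lebesgue" for n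
    unfolding F_def by (intro borel_measurable_times borel_measurable_indicator \<phi>m) simp
  have Fint: "integrable lebesgue (F n)" for n
  proof (rule Bochner_Integration.integrable_bound)
    have "integrable lebesgue (indicat_real (cball (0::'a) (real n)))"
      by (intro integrable_real_indicator) (auto intro: emeasure_bounded_finite[simplified])
    thus "integrable lebesgue (\<lambda>x. (cmod (\<phi> x))\<^sup>2 + indicat_real (cball 0 (real n)) x)"
      using \<phi> by (intro Bochner_Integration.integrable_add L2_integrable_square)
    \<comment> \<open>Applied to \<open>t = cmod (\<phi> x)\<close> on the ball, this bounds the
      truncation by an integrable function.\<close>
    have "t \<le> t\<^sup>2 + 1" for t :: real
      using zero_le_power2[of "t - 1/2"] by (simp add: power2_diff power_divide)
    thus "AE x in lebesgue. norm (F n x) \<le> norm ((cmod (\<phi> x))\<^sup>2 + indicat_real (cball 0 (real n)) x)"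
      by (auto simp: F_def indicator_def)
  qed measurable
  have F\<phi>: "converges_L2 F \<phi>"
  proof (rule L2_dominated_convergence[OF Fm \<phi>m L2_integrable_square[OF \<phi>]])
    show "cmod (F n x) \<le> cmod (\<phi> x)" for n x by (simp add: F_def indicator_def)
    show "AE x in lebesgue. (\<lambda>n. F n x) \<longlonglongrightarrow> \<phi> x"
    proof (rule AE_I2, rule tendsto_eventually)
      fix x
      show "\<forall>\<^sub>F n in sequentially. F n x = \<phi> x"
        using eventually_ge_at_top[of "nat \<lceil>norm x\<rceil>"]
      proof eventually_elim
        case (elim n)
        hence "norm x \<le> real n" by linarith
        thus ?case by (simp add: F_def)
      qed
    qed
  qed
  have FL2: "F n \<in> L2" and lim: "(\<lambda>n. norm_L2 (\<lambda>x. F n x - \<phi> x)) \<longlonglongrightarrow> 0" for n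
    using F\<phi> by (auto simp: converges_L2_def)
  have "\<exists>N. \<forall>m\<ge>N. \<forall>n\<ge>N. norm_L2 (\<lambda>w. fourier_L1 (F m) w - fourier_L1 (F n) w) \<le> e" if "e > 0" for e
  proof -
    obtain N where N: "\<And>n. n \<ge> N \<Longrightarrow> norm_L2 (\<lambda>x. F n x - \<phi> x) < e / 2"
      using order_tendstoD(2)[OF lim, of "e / 2"] \<open>e > 0\<close> by (auto simp: eventually_sequentially)
    have "norm_L2 (\<lambda>w. fourier_L1 (F m) w - fourier_L1 (F n) w) \<le> e" if "m \<ge> N" "n \<ge> N" for m n
    proof -
      have "norm_L2 (\<lambda>w. fourier_L1 (F m) w - fourier_L1 (F n) w) = norm_L2 (fourier_L1 (\<lambda>x. F m x - F n x))"
        by (simp add: fourier_L1_diff[OF Fint Fint, abs_def])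
      also have "\<dots> = norm_L2 (\<lambda>x. F m x - F n x)"
        by (intro norm_fourier_L1 L2_diff FL2 Bochner_Integration.integrable_diff Fint)
      also have "\<dots> \<le> norm_L2 (\<lambda>x. F m x - \<phi> x) + norm_L2 (\<lambda>x. \<phi> x - F n x)"
        by (intro norm_L2_triangle FL2 \<phi>)
      also have "\<dots> \<le> e"
        using N[OF \<open>m \<ge> N\<close>] N[OF \<open>n \<ge> N\<close>] norm_L2_minus_commute[of \<phi> "F n"] by linarith
      finally show ?thesis .
    qed
    thus ?thesis by blast
  qed
  then obtain g where "converges_L2 (\<lambda>n. fourier_L1 (F n)) g"
    using L2_complete[of "\<lambda>n. fourier_L1 (F n)"] fourier_L1_Plancherel(1)[OF Fint FL2] by blast
  thus ?thesis using Fint F\<phi> by (auto simp: is_fourier_L2_def)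
qed

lemma is_fourier_L2_fourier_L2: "\<phi> \<in> L2 \<Longrightarrow> is_fourier_L2 \<phi> (fourier_L2 \<phi>)"
  unfolding fourier_L2_def by (rule someI_ex[OF is_fourier_L2_exists])

section \<open>The Gram matrix of the translates and the Bessel bound\<close>

lemma fourier_L1_power_spectrum:
  assumes "\<phi> \<in> L2"
  shows "fourier_L1 (\<lambda>x. complex_of_real ((cmod (fourier_L2 \<phi> x))\<^sup>2)) (s - t)
    = inner_L2 (translate s \<phi>) (translate t \<phi>)"
proof -
  let ?g = "fourier_L2 \<phi>"
  have "fourier_L1 (\<lambda>x. complex_of_real ((cmod (?g x))\<^sup>2)) (s - t)
      = inner_L2 (\<lambda>w. iexp (2 * pi * ((t - s) \<bullet> w)) * ?g w) ?g"
    unfolding fourier_L1_def inner_L2_def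
  proof (rule Bochner_Integration.integral_cong[OF refl])
    fix x
    \<comment> \<open>With this sign convention, evaluation at \<open>s - t\<close> produces the
      character of \<open>t - s\<close>, the shift at which the autocorrelation is taken
      next.\<close>
    have "- 2 * of_real pi * \<i> * of_real (x \<bullet> (s - t)) = \<i> * complex_of_real (2 * pi * ((t - s) \<bullet> x))"
      by (simp add: inner_diff_left inner_diff_right inner_commute algebra_simps)
    thus "complex_of_real ((cmod (?g x))\<^sup>2) * exp (- 2 * of_real pi * \<i> * of_real (x \<bullet> (s - t)))
        = iexp (2 * pi * ((t - s) \<bullet> x)) * ?g x * cnj (?g x)"
      by (simp only: complex_norm_square mult_ac)
  qed
  also have "\<dots> = inner_L2 \<phi> (translate (t - s) \<phi>)"
    by (rule is_fourier_L2_correlation[OF is_fourier_L2_fourier_L2[OF assms]])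
  also have "\<dots> = inner_L2 (translate s \<phi>) (translate t \<phi>)"
    by (rule inner_L2_translate[symmetric]) (rule assms)+
  finally show ?thesis .
qed

lemma sum_le_infsum_ennreal:
  fixes f :: "'k \<Rightarrow> ennreal"
  assumes "finite S"
  shows "sum f S \<le> (\<Sum>\<^sub>\<infinity>k. f k)"
  by (subst nonneg_infsum_complete) (use assms in \<open>auto intro!: SUP_upper\<close>)

theorem corollary4p2:
  fixes \<phi> :: "real ^ 'd \<Rightarrow> complex"
    and \<Phi> :: "real ^ 'd \<Rightarrow> real"
    and \<Lambda> :: "int \<Rightarrow> real ^ 'd"
  assumes "\<phi> \<in> L2"
    and "\<Phi> = (\<lambda>w. (cmod (fourier_L2 \<phi> w))\<^sup>2)"
    and "(SUP k. \<Sum>\<^sub>\<infinity>l. ennreal (cmod (fourier_L1 (\<lambda>x. complex_of_real (\<Phi> x)) (\<Lambda> k - \<Lambda> l)))) < \<infinity>"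
  shows "bessel_L2 (\<lambda>k. translate (\<Lambda> k) \<phi>)"
proof -
  let ?\<psi> = "\<lambda>k. translate (\<Lambda> k) \<phi>"
  let ?G = "\<lambda>k l. cmod (inner_L2 (?\<psi> k) (?\<psi> l))"
  have \<psi>: "?\<psi> k \<in> L2" for k by (rule L2_translate[OF assms(1)])
  have gram: "fourier_L1 (\<lambda>x. complex_of_real (\<Phi> x)) (\<Lambda> k - \<Lambda> l) = inner_L2 (?\<psi> k) (?\<psi> l)" for k l
    unfolding assms(2) by (rule fourier_L1_power_spectrum[OF assms(1)])
  define m where "m = (SUP k. \<Sum>\<^sub>\<infinity>l. ennreal (?G k l))"
  have m: "m < \<infinity>" using assms(3) unfolding gram m_def .
  \<comment> \<open>The supremum \<open>m\<close> may be 0, whereas Schur's test and the Bessel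
    constant require a positive number.\<close>
  define M where "M = enn2real m + 1"
  have "M > 0" unfolding M_def by (simp add: add_nonneg_pos)
  have row: "(\<Sum>l\<in>S. ?G k l) \<le> M" if "finite S" for S k
  proof -
    have "ennreal (\<Sum>l\<in>S. ?G k l) = (\<Sum>l\<in>S. ennreal (?G k l))" by simp
    also have "\<dots> \<le> (\<Sum>\<^sub>\<infinity>l. ennreal (?G k l))" by (rule sum_le_infsum_ennreal[OF that])
    also have "\<dots> \<le> m" unfolding m_def by (rule SUP_upper) simp
    also have "m = ennreal (enn2real m)" using m by simp
    finally have "(\<Sum>l\<in>S. ?G k l) \<le> enn2real m" by (simp add: ennreal_le_iff)
    thus ?thesis by (simp add: M_def)
  qed
  have "(\<Sum>\<^sub>\<infinity>k. ennreal ((cmod (inner_L2 f (?\<psi> k)))\<^sup>2)) \<le> ennreal (M * (norm_L2 f)\<^sup>2)" if f: "f \<in> L2" for f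
  \<comment> \<open>The sum of nonnegative terms is the supremum of its finite partial sums, and
    Schur's test bounds these by a constant independent of \<open>S\<close>.\<close>
  proof (subst nonneg_infsum_complete)
    show "(SUP S\<in>{S. finite S \<and> S \<subseteq> UNIV}. \<Sum>k\<in>S. ennreal ((cmod (inner_L2 f (?\<psi> k)))\<^sup>2))
        \<le> ennreal (M * (norm_L2 f)\<^sup>2)"
    proof (rule SUP_least)
      fix S :: "int set" assume "S \<in> {S. finite S \<and> S \<subseteq> UNIV}"
      hence "finite S" by simp
      from Schur_Bessel_finite[of ?\<psi>, OF \<psi> f this \<open>M > 0\<close> row[OF this]]
      show "(\<Sum>k\<in>S. ennreal ((cmod (inner_L2 f (?\<psi> k)))\<^sup>2)) \<le> ennreal (M * (norm_L2 f)\<^sup>2)"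
        by (subst sum_ennreal) (auto intro: ennreal_leI)
    qed
  qed simp
  thus ?thesis using \<psi> \<open>M > 0\<close> by (auto simp: bessel_L2_def)
qed

end
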